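(* Let $\mathcal{M}$ be a Riemannian manifold and let $\mathcal{C}\subset\mathcal{M}$ be compact and uniquely geodesically convex. Assume that $\mathcal{C}$ is a Riemannian $\alpha$-strongly convex set for some $\alpha>0$. Then $\mathcal{C}$ satisfies the Riemannian scaling inequality.
   Context: Geodesics are smooth curves $\gamma:[0,1]\to\mathcal{M}$ with zero covariant acceleration. A closed set $\mathcal{C}\subseteq\mathcal{M}$ is (geodesically) convex if any $x,y\in\mathcal{C}$ are joined by a distance-minimizing geodesic contained in $\mathcal{C}$; it is uniquely geodesic if for any $x,y\in\mathcal{C}$ there is only one geodesic from $x$ to $y$ contained in $\mathcal{C}$; uniquely geodesically convex means both convex and uniquely geodesic. For such $\mathcal{C}$ and $x\in\mathcal{C}$, $\operatorname{Exp}_x^{-1}:\mathcal{C}\to\mathcal{C}_x$ denotes the inverse of the bijection $\operatorname{Exp}_x:\mathcal{C}_x\to\mathcal{C}$, where $\mathcal{C}_x=\{v\in T_x\mathcal{M}: t\mapsto \operatorname{Exp}_x(tv),\ t\in[0,1],\text{ is minimizing and }\operatorname{Exp}_x(v)\in\mathcal{C}\}$. The inner product and norm on $T_x\mathcal{M}$ are $\langle\cdot;\cdot\rangle_x$ and $\|\cdot\|_x$. Euclidean strong convexity: a compact convex set $K$ in a finite-dimensional inner product space is $\alpha$-strongly convex w.r.t. the induced norm $\|\cdot\|$ if for all $p,q\in K$, $t\in[0,1]$ and all $z$ with $\|z\|=1$, $(1-t)p+tq+\alpha t(1-t)\|p-q\|^2z\in K$. Riemannian $\alpha$-strong convexity: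 $\mathcal{C}$ is a Riemannian $\alpha$-strongly convex set if for every $x\in\mathcal{C}$ the set $\operatorname{Exp}_x^{-1}(\mathcal{C})=\{\operatorname{Exp}_x^{-1}(z): z\in\mathcal{C}\}\subset T_x\mathcal{M}$ is $\alpha$-strongly convex w.r.t. $\|\cdot\|_x$ in the Euclidean sense. Riemannian scaling inequality: $\mathcal{C}$ satisfies the Riemannian scaling inequality if there is a constant $\beta>0$ such that for all $x\in\mathcal{C}$, all $w\in T_x\mathcal{M}$ and all $v\in\operatorname{argmax}_{z\in\mathcal{C}}\langle w;\operatorname{Exp}_x^{-1}(z)\rangle_x$, $$\langle w;\operatorname{Exp}_x^{-1}(v)\rangle_x\ \ge\ \beta\,\|w\|_x\,\|\operatorname{Exp}_x^{-1}(v)\|_x^2 .$$ *)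

theory Defs
  imports "HOL-Analysis.Analysis"
begin

section \<open>Smooth maps and smooth atlases\<close>

text \<open>Only meaningful for open \<open>S\<close>. In finite dimension, differentiability together with
  continuity of all directional derivatives is the usual notion of class C1, and so on.\<close>

primrec Ck_on :: "nat \<Rightarrow> 'a::real_normed_vector set \<Rightarrow> ('a \<Rightarrow> 'b::real_normed_vector) \<Rightarrow> bool" where
  "Ck_on 0 S f \<longleftrightarrow> continuous_on S f"
| "Ck_on (Suc k) S f \<longleftrightarrow> (\<forall>x\<in>S. f differentiable (at x)) \<and>
     (\<forall>v. Ck_on k S (\<lambda>x. frechet_derivative f (at x) v))"

definition smooth_on :: "'a::real_normed_vector set \<Rightarrow> ('a \<Rightarrow> 'b::real_normed_vector) \<Rightarrow> bool" where
  "smooth_on S f \<longleftrightarrow> (\<forall>k. Ck_on k S f)"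

text \<open>A chart is a pair \<open>(U, \<phi>)\<close>; the values of \<open>\<phi>\<close> outside \<open>U\<close> are irrelevant. The manifold is
  the whole type \<open>'m\<close>, whose type classes (used in \<open>riemannian_manifold\<close>) make it Hausdorff and
  second countable; it need be neither connected nor complete.\<close>

type_synonym ('m, 'e) chart = "'m set \<times> ('m \<Rightarrow> 'e)"

definition chart_inv :: "('m, 'e) chart \<Rightarrow> 'e \<Rightarrow> 'm" where
  "chart_inv c = inv_into (fst c) (snd c)"

definition is_chart :: "('m::topological_space, 'e::euclidean_space) chart \<Rightarrow> bool" where
  "is_chart c \<longleftrightarrow> open (fst c) \<and> open (snd c ` fst c) \<and>
     homeomorphism (fst c) (snd c ` fst c) (snd c) (chart_inv c)"

definition smooth_atlas :: "('m::topological_space, 'e::euclidean_space) chart set \<Rightarrow> bool" where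
  "smooth_atlas A \<longleftrightarrow> (\<forall>c\<in>A. is_chart c) \<and> (\<Union>c\<in>A. fst c) = UNIV \<and>
     (\<forall>c\<in>A. \<forall>d\<in>A. smooth_on (snd c ` (fst c \<inter> fst d)) (snd d \<circ> chart_inv c))"


section \<open>Tangent spaces and Riemannian metrics\<close>

text \<open>The tangent space at \<open>x\<close> is the model space \<open>'e\<close>: a tangent vector at \<open>x\<close> is represented
  by its coordinates in one fixed preferred chart \<open>chart_at A x\<close>. Thus each tangent space carries
  its vector space structure and topology from \<open>'e\<close>, whereas its inner product is \<open>g x\<close> and
  not the one of \<open>'e\<close>.\<close>

definition chart_at :: "('m, 'e) chart set \<Rightarrow> 'm \<Rightarrow> ('m, 'e) chart" where
  "chart_at A x = (SOME c. c \<in> A \<and> x \<in> fst c)"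

definition tangent_of_coords ::
  "('m, 'e::euclidean_space) chart set \<Rightarrow> ('m, 'e) chart \<Rightarrow> 'm \<Rightarrow> 'e \<Rightarrow> 'e" where
  "tangent_of_coords A c x u =
     frechet_derivative (snd (chart_at A x) \<circ> chart_inv c) (at (snd c x)) u"

definition is_inner_product :: "('e::real_vector \<Rightarrow> 'e \<Rightarrow> real) \<Rightarrow> bool" where
  "is_inner_product ip \<longleftrightarrow> bilinear ip \<and> (\<forall>u v. ip u v = ip v u) \<and> (\<forall>u. u \<noteq> 0 \<longrightarrow> ip u u > 0)"

definition ip_norm :: "('e \<Rightarrow> 'e \<Rightarrow> real) \<Rightarrow> 'e \<Rightarrow> real" where
  "ip_norm ip v = sqrt (ip v v)"

definition local_metric ::
  "('m, 'e::euclidean_space) chart set \<Rightarrow> ('m \<Rightarrow> 'e \<Rightarrow> 'e \<Rightarrow> real) \<Rightarrow> ('m, 'e) chart \<Rightarrow> 'e \<Rightarrow> 'e \<Rightarrow> 'e \<Rightarrow> real" where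
  "local_metric A g c p u v =
     g (chart_inv c p) (tangent_of_coords A c (chart_inv c p) u)
                       (tangent_of_coords A c (chart_inv c p) v)"

definition riemannian_manifold ::
  "('m::{t2_space, second_countable_topology}, 'e::euclidean_space) chart set
    \<Rightarrow> ('m \<Rightarrow> 'e \<Rightarrow> 'e \<Rightarrow> real) \<Rightarrow> bool" where
  "riemannian_manifold A g \<longleftrightarrow> smooth_atlas A \<and> (\<forall>x. is_inner_product (g x)) \<and>
     (\<forall>c\<in>A. \<forall>u v. smooth_on (snd c ` fst c) (\<lambda>p. local_metric A g c p u v))"


section \<open>Curves, length and distance\<close>

text \<open>Smoothness on an interval \<open>I\<close> of the real line, one-sided at end points contained in \<open>I\<close>:
  \<open>D k\<close> is the \<open>k\<close>-th derivative of the curve in the chart \<open>c\<close>.\<close>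

definition smooth_curve_on ::
  "('m::topological_space, 'e::euclidean_space) chart set \<Rightarrow> real set \<Rightarrow> (real \<Rightarrow> 'm) \<Rightarrow> bool" where
  "smooth_curve_on A I \<gamma> \<longleftrightarrow> continuous_on I \<gamma> \<and>
     (\<forall>c\<in>A. \<exists>D. \<forall>t\<in>{t\<in>I. \<gamma> t \<in> fst c}. D 0 t = snd c (\<gamma> t) \<and>
        (\<forall>k::nat. (D k has_vector_derivative D (Suc k) t) (at t within {t\<in>I. \<gamma> t \<in> fst c})))"

definition piecewise_smooth_curve ::
  "('m::topological_space, 'e::euclidean_space) chart set \<Rightarrow> (real \<Rightarrow> 'm) \<Rightarrow> bool" where
  "piecewise_smooth_curve A \<gamma> \<longleftrightarrow> continuous_on {0..1} \<gamma> \<and>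
     (\<exists>P. finite P \<and> {0, 1} \<subseteq> P \<and> P \<subseteq> {0..1} \<and>
        (\<forall>a\<in>P. \<forall>b\<in>P. a < b \<and> {a<..<b} \<inter> P = {} \<longrightarrow> smooth_curve_on A {a..b} \<gamma>))"

text \<open>All curves are parametrised by \<open>{0..1}\<close>; values outside play no role.\<close>

definition velocity ::
  "('m, 'e::euclidean_space) chart set \<Rightarrow> (real \<Rightarrow> 'm) \<Rightarrow> real \<Rightarrow> 'e" where
  "velocity A \<gamma> t = vector_derivative (snd (chart_at A (\<gamma> t)) \<circ> \<gamma>) (at t within {0..1})"

definition curve_length ::
  "('m, 'e::euclidean_space) chart set \<Rightarrow> ('m \<Rightarrow> 'e \<Rightarrow> 'e \<Rightarrow> real) \<Rightarrow> (real \<Rightarrow> 'm) \<Rightarrow> real" where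
  "curve_length A g \<gamma> = integral {0..1} (\<lambda>t. ip_norm (g (\<gamma> t)) (velocity A \<gamma> t))"

text \<open>The infimum is meaningful only for points in the same component; it is only ever compared
  with the length of a curve joining the two points.\<close>

definition riem_dist ::
  "('m::topological_space, 'e::euclidean_space) chart set \<Rightarrow> ('m \<Rightarrow> 'e \<Rightarrow> 'e \<Rightarrow> real) \<Rightarrow> 'm \<Rightarrow> 'm \<Rightarrow> real" where
  "riem_dist A g x y =
     Inf {curve_length A g \<gamma> | \<gamma>. piecewise_smooth_curve A \<gamma> \<and> \<gamma> 0 = x \<and> \<gamma> 1 = y}"

definition minimizing ::
  "('m::topological_space, 'e::euclidean_space) chart set \<Rightarrow> ('m \<Rightarrow> 'e \<Rightarrow> 'e \<Rightarrow> real) \<Rightarrow> (real \<Rightarrow> 'm) \<Rightarrow> bool" where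
  "minimizing A g \<gamma> \<longleftrightarrow> curve_length A g \<gamma> = riem_dist A g (\<gamma> 0) (\<gamma> 1)"


section \<open>Geodesics and the exponential map\<close>

text \<open>The Christoffel map of the Levi-Civita connection in the chart \<open>c\<close>: the covariant derivative
  of the constant coordinate field \<open>v\<close> along \<open>u\<close>, given by the Koszul formula. In a basis this is
  the usual expression of the Christoffel symbols through the derivatives of the metric.\<close>

definition christoffel ::
  "('m, 'e::euclidean_space) chart set \<Rightarrow> ('m \<Rightarrow> 'e \<Rightarrow> 'e \<Rightarrow> real) \<Rightarrow> ('m, 'e) chart \<Rightarrow> 'e \<Rightarrow> 'e \<Rightarrow> 'e \<Rightarrow> 'e" where
  "christoffel A g c p u v = (THE z. \<forall>w. local_metric A g c p z w =
     (frechet_derivative (\<lambda>q. local_metric A g c q v w) (at p) u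
    + frechet_derivative (\<lambda>q. local_metric A g c q u w) (at p) v
    - frechet_derivative (\<lambda>q. local_metric A g c q u v) (at p) w) / 2)"

definition covariant_acceleration ::
  "('m, 'e::euclidean_space) chart set \<Rightarrow> ('m \<Rightarrow> 'e \<Rightarrow> 'e \<Rightarrow> real) \<Rightarrow> ('m, 'e) chart \<Rightarrow> (real \<Rightarrow> 'm) \<Rightarrow> real \<Rightarrow> 'e" where
  "covariant_acceleration A g c \<gamma> t =
     (let u' = (\<lambda>s. vector_derivative (snd c \<circ> \<gamma>) (at s within {0..1}))
      in vector_derivative u' (at t within {0..1})
         + christoffel A g c (snd c (\<gamma> t)) (u' t) (u' t))"

definition geodesic ::
  "('m::topological_space, 'e::euclidean_space) chart set \<Rightarrow> ('m \<Rightarrow> 'e \<Rightarrow> 'e \<Rightarrow> real) \<Rightarrow> (real \<Rightarrow> 'm) \<Rightarrow> bool" where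
  "geodesic A g \<gamma> \<longleftrightarrow> smooth_curve_on A {0..1} \<gamma> \<and>
     (\<forall>c\<in>A. \<forall>t\<in>{0..1}. \<gamma> t \<in> fst c \<longrightarrow> covariant_acceleration A g c \<gamma> t = 0)"

text \<open>Without completeness, the exponential map at \<open>x\<close> is defined only on \<open>exp_dom A g x\<close>. There,
  the description below is proper because a geodesic is determined by its initial velocity.\<close>

definition exp_dom ::
  "('m::topological_space, 'e::euclidean_space) chart set \<Rightarrow> ('m \<Rightarrow> 'e \<Rightarrow> 'e \<Rightarrow> real) \<Rightarrow> 'm \<Rightarrow> 'e set" where
  "exp_dom A g x = {v. \<exists>\<gamma>. geodesic A g \<gamma> \<and> \<gamma> 0 = x \<and> velocity A \<gamma> 0 = v}"

definition riem_exp ::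
  "('m::topological_space, 'e::euclidean_space) chart set \<Rightarrow> ('m \<Rightarrow> 'e \<Rightarrow> 'e \<Rightarrow> real) \<Rightarrow> 'm \<Rightarrow> 'e \<Rightarrow> 'm" where
  "riem_exp A g x v =
     (THE y. \<exists>\<gamma>. geodesic A g \<gamma> \<and> \<gamma> 0 = x \<and> velocity A \<gamma> 0 = v \<and> \<gamma> 1 = y)"


section \<open>Geodesic convexity and the inverse exponential map\<close>

definition geodesically_convex ::
  "('m::topological_space, 'e::euclidean_space) chart set \<Rightarrow> ('m \<Rightarrow> 'e \<Rightarrow> 'e \<Rightarrow> real) \<Rightarrow> 'm set \<Rightarrow> bool" where
  "geodesically_convex A g C \<longleftrightarrow> closed C \<and>
     (\<forall>x\<in>C. \<forall>y\<in>C. \<exists>\<gamma>. geodesic A g \<gamma> \<and> minimizing A g \<gamma> \<and> \<gamma> 0 = x \<and> \<gamma> 1 = y \<and> \<gamma> ` {0..1} \<subseteq> C)"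

definition uniquely_geodesic ::
  "('m::topological_space, 'e::euclidean_space) chart set \<Rightarrow> ('m \<Rightarrow> 'e \<Rightarrow> 'e \<Rightarrow> real) \<Rightarrow> 'm set \<Rightarrow> bool" where
  "uniquely_geodesic A g C \<longleftrightarrow>
     (\<forall>x\<in>C. \<forall>y\<in>C. \<exists>\<gamma>. geodesic A g \<gamma> \<and> \<gamma> 0 = x \<and> \<gamma> 1 = y \<and> \<gamma> ` {0..1} \<subseteq> C \<and>
        (\<forall>\<sigma>. geodesic A g \<sigma> \<and> \<sigma> 0 = x \<and> \<sigma> 1 = y \<and> \<sigma> ` {0..1} \<subseteq> C \<longrightarrow> (\<forall>t\<in>{0..1}. \<sigma> t = \<gamma> t)))"

definition uniquely_geodesically_convex ::
  "('m::topological_space, 'e::euclidean_space) chart set \<Rightarrow> ('m \<Rightarrow> 'e \<Rightarrow> 'e \<Rightarrow> real) \<Rightarrow> 'm set \<Rightarrow> bool" where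
  "uniquely_geodesically_convex A g C \<longleftrightarrow> geodesically_convex A g C \<and> uniquely_geodesic A g C"

definition log_range ::
  "('m::topological_space, 'e::euclidean_space) chart set \<Rightarrow> ('m \<Rightarrow> 'e \<Rightarrow> 'e \<Rightarrow> real) \<Rightarrow> 'm set \<Rightarrow> 'm \<Rightarrow> 'e set" where
  "log_range A g C x = {v \<in> exp_dom A g x.
     minimizing A g (\<lambda>t. riem_exp A g x (t *\<^sub>R v)) \<and> riem_exp A g x v \<in> C}"

definition riem_log ::
  "('m::topological_space, 'e::euclidean_space) chart set \<Rightarrow> ('m \<Rightarrow> 'e \<Rightarrow> 'e \<Rightarrow> real) \<Rightarrow> 'm set \<Rightarrow> 'm \<Rightarrow> 'm \<Rightarrow> 'e" where
  "riem_log A g C x = inv_into (log_range A g C x) (riem_exp A g x)"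


section \<open>Strong convexity and the scaling inequality\<close>

definition strongly_convex_set ::
  "('e::euclidean_space \<Rightarrow> 'e \<Rightarrow> real) \<Rightarrow> real \<Rightarrow> 'e set \<Rightarrow> bool" where
  "strongly_convex_set ip \<alpha> K \<longleftrightarrow> compact K \<and> convex K \<and>
     (\<forall>p\<in>K. \<forall>q\<in>K. \<forall>t\<in>{0..1}. \<forall>z. ip_norm ip z = 1 \<longrightarrow>
        (1 - t) *\<^sub>R p + t *\<^sub>R q + (\<alpha> * t * (1 - t) * (ip_norm ip (p - q))\<^sup>2) *\<^sub>R z \<in> K)"

definition riemannian_strongly_convex ::
  "('m::topological_space, 'e::euclidean_space) chart set \<Rightarrow> ('m \<Rightarrow> 'e \<Rightarrow> 'e \<Rightarrow> real) \<Rightarrow> real \<Rightarrow> 'm set \<Rightarrow> bool" where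
  "riemannian_strongly_convex A g \<alpha> C \<longleftrightarrow>
     (\<forall>x\<in>C. strongly_convex_set (g x) \<alpha> (riem_log A g C x ` C))"

definition riemannian_scaling_inequality ::
  "('m::topological_space, 'e::euclidean_space) chart set \<Rightarrow> ('m \<Rightarrow> 'e \<Rightarrow> 'e \<Rightarrow> real) \<Rightarrow> 'm set \<Rightarrow> bool" where
  "riemannian_scaling_inequality A g C \<longleftrightarrow>
     (\<exists>\<beta>>0. \<forall>x\<in>C. \<forall>w v. is_arg_max (\<lambda>z. g x w (riem_log A g C x z)) (\<lambda>z. z \<in> C) v \<longrightarrow>
        g x w (riem_log A g C x v)
          \<ge> \<beta> * ip_norm (g x) w * (ip_norm (g x) (riem_log A g C x v))\<^sup>2)"

end

theory Submission
  imports Defs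
begin

text \<open>
  Fix \<open>x \<in> C\<close> and let \<open>K\<close> be the strongly convex set \<open>Exp\<^sub>x\<^sup>-\<^sup>1(C)\<close>. If \<open>p\<close> maximizes \<open>\<langle>w; _\<rangle>\<close> over \<open>K\<close>,
  then \<open>K\<close> contains \<open>p/2 + (\<alpha>/4) \<parallel>p\<parallel>\<^sup>2 w/\<parallel>w\<parallel>\<close>, the perturbed midpoint of \<open>p\<close> and \<open>0\<close>; comparing the values
  of \<open>\<langle>w; _\<rangle>\<close> gives the scaling inequality with \<open>\<beta> = \<alpha>/2\<close>.

  The geometric content is \<open>Exp\<^sub>x\<^sup>-\<^sup>1(x) = 0\<close>, hence \<open>0 \<in> K\<close>. A minimizing geodesic from \<open>x\<close> to \<open>x\<close>
  has length \<open>0\<close>, and its speed is continuous, so its initial velocity vanishes. That \<open>Exp\<close> and its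
  inverse are attached to actual geodesics at all rests on uniqueness of geodesics with given initial
  velocity: in a chart, two geodesics satisfy a second-order differential inequality, since the metric
  and its first derivatives are locally Lipschitz and the metric is uniformly positive on compact sets.
\<close>

section \<open>Analysis in the model space\<close>

lemma strongly_convex_scaling:
  assumes ip: "is_inner_product ip" and K: "strongly_convex_set ip \<alpha> K"
    and "0 \<in> K" "p \<in> K" and max: "\<And>q. q \<in> K \<Longrightarrow> ip w q \<le> ip w p"
  shows "\<alpha> / 2 * ip_norm ip w * (ip_norm ip p)\<^sup>2 \<le> ip w p"
proof (cases "w = 0")
  case True
  have "bilinear ip" using ip by (simp add: is_inner_product_def)
  \<comment> \<open>Both sides vanish here; the case is split off because the normalisation of
    \<open>w\<close> below divides by its norm.\<close>
  then show ?thesis by (simp add: True ip_norm_def bilinear_lzero)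
next
  case False
  have bil: "bilinear ip" and pos: "ip w w > 0" using ip False by (auto simp: is_inner_product_def)
  define n where "n = ip_norm ip w"
  have n: "n > 0" "n * n = ip w w" using pos by (simp_all add: n_def ip_norm_def)
  define z where "z = w /\<^sub>R n"
  have "ip z z = ip w w / (n * n)"
    by (simp add: z_def bilinear_lmul[OF bil] bilinear_rmul[OF bil] divide_inverse)
  then have "ip z z = 1" unfolding n(2) using pos by simp
  then have z: "ip_norm ip z = 1" by (simp add: ip_norm_def)
  have wz: "ip w z = n" using n(1) by (simp add: z_def bilinear_rmul[OF bil] flip: n(2))
  let ?N = "(ip_norm ip p)\<^sup>2"
  \<comment> \<open>Strong convexity between \<open>p\<close> and 0 with perturbation direction
    \<open>z\<close>. Parameter \<open>t\<close> in place of 1/2 would give the constant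
    \<open>\<alpha> * (1 - t)\<close>; the midpoint gives \<open>\<alpha> / 2\<close>.\<close>
  have "(1 - 1/2) *\<^sub>R p + (1/2) *\<^sub>R 0 + (\<alpha> * (1/2) * (1 - 1/2) * (ip_norm ip (p - 0))\<^sup>2) *\<^sub>R z \<in> K"
    using K \<open>p \<in> K\<close> \<open>0 \<in> K\<close> z unfolding strongly_convex_set_def
    by (elim conjE) (drule bspec, assumption, drule bspec, assumption, drule bspec[of _ _ "1/2"], auto)
  then have "(1/2) *\<^sub>R p + (\<alpha> / 4 * ?N) *\<^sub>R z \<in> K" by simp
  from max[OF this] have "1/2 * ip w p + \<alpha> / 4 * ?N * n \<le> ip w p"
    by (simp add: bilinear_radd[OF bil] bilinear_rmul[OF bil] wz)
  then show ?thesis by (simp add: n_def field_simps)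
qed

text \<open>Riesz representation for an inner product other than the built-in one of
  \<open>'e\<close>. Definiteness makes \<open>T\<close>, which collects the values of
  \<open>ip z\<close> on the basis, injective, and equality of dimensions makes it surjective. It
  makes the description in \<open>christoffel\<close> proper.\<close>

lemma inner_product_represents:
  fixes ip :: "'e::euclidean_space \<Rightarrow> 'e \<Rightarrow> real"
  assumes ip: "is_inner_product ip" and f: "linear f"
  shows "\<exists>!z. \<forall>w. ip z w = f w"
proof -
  have bil: "bilinear ip" and pos: "\<And>u. u \<noteq> 0 \<Longrightarrow> ip u u > 0"
    using ip by (auto simp: is_inner_product_def)
  define T where "T z = (\<Sum>i\<in>Basis. ip z i *\<^sub>R i)" for z
  have T: "T z \<bullet> i = ip z i" if "i \<in> Basis" for z i
    using that by (simp add: T_def)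
  have ext: "ip z w = (\<Sum>i\<in>Basis. (w \<bullet> i) * ip z i)" for z w
  proof -
    have l: "linear (ip z)" using bil by (simp add: bilinear_def)
    have "ip z w = ip z (\<Sum>i\<in>Basis. (w \<bullet> i) *\<^sub>R i)" by (simp add: euclidean_representation)
    also have "\<dots> = (\<Sum>i\<in>Basis. (w \<bullet> i) * ip z i)"
      by (simp add: linear_sum[OF l] linear_cmul[OF l])
    finally show ?thesis .
  qed
  have zero: "z = z'" if "\<forall>w. ip z w = ip z' w" for z z'
  proof (rule ccontr)
    assume "z \<noteq> z'"
    then have "ip (z - z') (z - z') > 0" using pos by simp
    moreover have "ip (z - z') (z - z') = 0"
      using that by (simp add: bilinear_lsub[OF bil])
    ultimately show False by simp
  qed
  have linT: "linear T"
    by (rule linearI)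
       (simp_all add: T_def bilinear_ladd[OF bil] bilinear_lmul[OF bil] scaleR_add_left sum.distrib
          scaleR_sum_right)
  have "inj T"
  proof (rule injI)
    fix z z' assume "T z = T z'"
    then have "ip z i = ip z' i" if "i \<in> Basis" for i using T[OF that] by metis
    then have "\<forall>w. ip z w = ip z' w" by (metis (no_types, lifting) ext sum.cong)
    then show "z = z'" by (rule zero)
  qed
  then have "surj T" using linear_injective_imp_surjective[OF linT] by simp
  then obtain z where z: "T z = (\<Sum>i\<in>Basis. f i *\<^sub>R i)" by (metis surjD)
  have "ip z w = f w" for w
  proof -
    have zi: "ip z i = f i" if "i \<in> Basis" for i
      using T[OF that, of z] that by (simp add: z)
    have "f w = f (\<Sum>i\<in>Basis. (w \<bullet> i) *\<^sub>R i)" by (simp add: euclidean_representation)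
    also have "\<dots> = (\<Sum>i\<in>Basis. (w \<bullet> i) * ip z i)"
      by (simp add: linear_sum[OF f] linear_cmul[OF f] zi)
    finally show ?thesis using ext[of z w] by simp
  qed
  then show ?thesis using zero by metis
qed

section \<open>Smooth functions: derivatives and Lipschitz bounds\<close>

lemma smooth_on_differentiable:
  assumes "smooth_on S f" "x \<in> S"
  shows "f differentiable (at x)"
  using assms(1)[unfolded smooth_on_def, rule_format, of "Suc 0"] assms(2) by simp

lemma smooth_on_continuous:
  assumes "smooth_on S f"
  shows "continuous_on S f"
  using assms[unfolded smooth_on_def, rule_format, of 0] by simp

lemma smooth_on_derivative:
  assumes "smooth_on S f"
  shows "smooth_on S (\<lambda>x. frechet_derivative f (at x) v)"
  unfolding smooth_on_def
proof
  fix k show "Ck_on k S (\<lambda>x. frechet_derivative f (at x) v)"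
    using assms[unfolded smooth_on_def, rule_format, of "Suc k"] by simp
qed

text \<open>Compactness bounds the finitely many partial derivatives, hence the operator norm of the
  derivative; convexity keeps segments inside \<open>K\<close>, so that the mean value inequality
  applies.\<close>

lemma smooth_on_lipschitz:
  fixes f :: "'a::euclidean_space \<Rightarrow> real"
  assumes f: "smooth_on S f" and K: "compact K" "convex K" "K \<subseteq> S"
  obtains L where "L \<ge> 0" "\<And>x y. x \<in> K \<Longrightarrow> y \<in> K \<Longrightarrow> \<bar>f x - f y\<bar> \<le> L * norm (x - y)"
proof -
  have "\<exists>B. \<forall>x\<in>K. norm (frechet_derivative f (at x) i) \<le> B" for i
  proof -
    have "continuous_on K (\<lambda>x. frechet_derivative f (at x) i)"
      using smooth_on_continuous[OF smooth_on_derivative[OF f]] K(3) by (rule continuous_on_subset)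
    then have "bounded ((\<lambda>x. frechet_derivative f (at x) i) ` K)"
      using K(1) compact_continuous_image compact_imp_bounded by blast
    then show ?thesis by (auto simp: bounded_iff)
  qed
  then obtain B where B: "\<And>i x. x \<in> K \<Longrightarrow> norm (frechet_derivative f (at x) i) \<le> B i" by metis
  \<comment> \<open>The absolute value gives \<open>L \<ge> 0\<close> without a case split: for
    empty \<open>K\<close> the bounds \<open>B i\<close> are unconstrained.\<close>
  define L where "L = \<bar>\<Sum>i\<in>Basis. B i\<bar>"
  have on: "onorm (frechet_derivative f (at x)) \<le> L" if "x \<in> K" for x
  proof (rule onorm_le)
    fix h
    have "f differentiable (at x)" using smooth_on_differentiable[OF f] that K(3) by blast
    then have lin: "linear (frechet_derivative f (at x))" by (rule linear_frechet_derivative)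
    have "frechet_derivative f (at x) h = frechet_derivative f (at x) (\<Sum>i\<in>Basis. (h \<bullet> i) *\<^sub>R i)"
      by (simp add: euclidean_representation)
    also have "\<dots> = (\<Sum>i\<in>Basis. (h \<bullet> i) * frechet_derivative f (at x) i)"
      by (simp add: linear_sum[OF lin] linear_cmul[OF lin])
    also have "norm \<dots> \<le> (\<Sum>i\<in>Basis. norm h * B i)"
      by (rule sum_norm_le) (auto simp: abs_mult intro!: mult_mono Basis_le_norm B[OF that, simplified])
    also have "\<dots> \<le> L * norm h"
      unfolding L_def sum_distrib_left[symmetric]
      by (subst mult.commute) (intro mult_right_mono, auto)
    finally show "norm (frechet_derivative f (at x) h) \<le> L * norm h" .
  qed
  show ?thesis
  proof
    show "L \<ge> 0" by (simp add: L_def)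
    fix x y assume "x \<in> K" "y \<in> K"
    have "norm (f x - f y) \<le> L * norm (x - y)"
    proof (rule differentiable_bound[OF K(2)])
      fix z assume "z \<in> K"
      then have "f differentiable (at z)" using smooth_on_differentiable[OF f] K(3) by blast
      then show "(f has_derivative frechet_derivative f (at z)) (at z within K)"
        using frechet_derivative_works has_derivative_at_withinI by blast
      show "onorm (frechet_derivative f (at z)) \<le> L" using on \<open>z \<in> K\<close> by simp
    qed fact+
    then show "\<bar>f x - f y\<bar> \<le> L * norm (x - y)" by simp
  qed
qed

text \<open>The estimate compares the two given curves only along themselves, which is the form in
  which the geodesic equation supplies it.\<close>

lemma second_order_unique:
  fixes a b :: "real \<Rightarrow> 'e::euclidean_space"
  assumes a: "\<And>t. t \<in> {s..r} \<Longrightarrow> (a has_vector_derivative a' t) (at t within {s..r})"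
    and a': "\<And>t. t \<in> {s..r} \<Longrightarrow> (a' has_vector_derivative a'' t) (at t within {s..r})"
    and b: "\<And>t. t \<in> {s..r} \<Longrightarrow> (b has_vector_derivative b' t) (at t within {s..r})"
    and b': "\<And>t. t \<in> {s..r} \<Longrightarrow> (b' has_vector_derivative b'' t) (at t within {s..r})"
    and M: "M \<ge> 0"
      "\<And>t. t \<in> {s..r} \<Longrightarrow> norm (a'' t - b'' t) \<le> M * (norm (a t - b t) + norm (a' t - b' t))"
    and init: "a s = b s" "a' s = b' s"
    and t: "t \<in> {s..r}"
  shows "a t = b t"
proof -
  (* Gronwall: the energy |a - b|^2 + |a' - b'|^2, damped by exp (- (1 + 3 M) t), is nonincreasing
     and vanishes at s. *)
  define x where "x t = a t - b t" for t
  define y where "y t = a' t - b' t" for t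
  define z where "z t = a'' t - b'' t" for t
  define E where "E t = (x t \<bullet> x t + y t \<bullet> y t) * exp (- (1 + 3 * M) * t)" for t
  define E' where "E' t = ((2 * (x t \<bullet> y t) + 2 * (y t \<bullet> z t)) - (1 + 3 * M) * (x t \<bullet> x t + y t \<bullet> y t))
     * exp (- (1 + 3 * M) * t)" for t
  have dx: "(x has_vector_derivative y t) (at t within {s..r})" if "t \<in> {s..r}" for t
    unfolding x_def y_def by (intro derivative_intros a b that)
  have dy: "(y has_vector_derivative z t) (at t within {s..r})" if "t \<in> {s..r}" for t
    unfolding y_def z_def by (intro derivative_intros a' b' that)
  have dE: "(E has_real_derivative E' t) (at t within {s..r})" if "t \<in> {s..r}" for t
    unfolding E_def E'_def has_field_derivative_def
    using dx[OF that, unfolded has_vector_derivative_def] dy[OF that, unfolded has_vector_derivative_def]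
    by (auto intro!: derivative_eq_intros simp: algebra_simps inner_commute)
  \<comment> \<open>The damping rate is what the estimate costs: the mixed terms contribute at most
    \<open>1 + M\<close> times the energy, and the remaining term at most \<open>2 * M\<close> times
    it.\<close>
  have neg: "E' t \<le> 0" if "t \<in> {s..r}" for t
  proof -
    have xy: "2 * (x t \<bullet> y t) \<le> 2 * (norm (x t) * norm (y t))"
      using norm_cauchy_schwarz[of "x t" "y t"] by simp
    have "norm (z t) \<le> M * (norm (x t) + norm (y t))"
      using M(2)[OF that] by (simp add: x_def y_def z_def)
    then have yz: "2 * (y t \<bullet> z t) \<le> 2 * (norm (y t) * (M * (norm (x t) + norm (y t))))"
      using norm_cauchy_schwarz[of "y t" "z t"] mult_left_mono[of "norm (z t)" _ "norm (y t)"]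
      by (smt (verit) norm_ge_zero)
    have sq: "2 * (norm (x t) * norm (y t)) \<le> (norm (x t))\<^sup>2 + (norm (y t))\<^sup>2"
      using sum_squares_bound[of "norm (x t)" "norm (y t)"] by (simp add: power2_eq_square)
    have "2 * (x t \<bullet> y t) + 2 * (y t \<bullet> z t)
        \<le> (1 + M) * (2 * (norm (x t) * norm (y t))) + 2 * M * (norm (y t))\<^sup>2"
      using xy yz by (simp add: algebra_simps power2_eq_square)
    also have "\<dots> \<le> (1 + M) * ((norm (x t))\<^sup>2 + (norm (y t))\<^sup>2) + 2 * M * (norm (y t))\<^sup>2"
      using mult_left_mono[OF sq, of "1 + M"] M(1) by simp
    also have "\<dots> \<le> (1 + 3 * M) * ((norm (x t))\<^sup>2 + (norm (y t))\<^sup>2)"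
      using M(1) by (simp add: algebra_simps)
    finally show ?thesis
      unfolding E'_def by (simp add: power2_norm_eq_inner mult_nonpos_nonneg)
  qed
  have "E t \<le> E s"
  proof (rule DERIV_nonpos_imp_decreasing_open[of s t E])
    show "s \<le> t" using t by simp
    show "\<exists>y. (E has_real_derivative y) (at u) \<and> y \<le> 0" if "s < u" "u < t" for u
    proof -
      have "u \<in> {s..r}" "u \<in> interior {s..r}" using that t by auto
      then show ?thesis using dE[of u] neg[of u] at_within_interior[of u "{s..r}"] by auto
    qed
    have "continuous_on {s..r} E" by (rule DERIV_continuous_on) (rule dE)
    then show "continuous_on {s..t} E" by (rule continuous_on_subset) (use t in auto)
  qed
  then have "E t \<le> 0" using init by (simp add: E_def x_def y_def)
  then have "x t \<bullet> x t + y t \<bullet> y t \<le> 0" by (simp add: E_def mult_le_0_iff not_le_imp_less)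
  moreover have "x t \<bullet> x t \<ge> 0" "y t \<bullet> y t \<ge> 0" by simp_all
  ultimately have "x t \<bullet> x t = 0" by linarith
  then show ?thesis by (simp add: x_def)
qed

text \<open>The relation is stable under sums and products, so that the difference of two expressions
  polynomial in comparable quantities is bounded by a multiple of \<open>e\<close>. It turns smoothness of the
  metric into the Lipschitz estimate for the geodesic equation.\<close>

definition comparable :: "'t set \<Rightarrow> ('t \<Rightarrow> real) \<Rightarrow> ('t \<Rightarrow> real) \<Rightarrow> ('t \<Rightarrow> real) \<Rightarrow> bool" where
  "comparable S e f h \<longleftrightarrow>
     (\<exists>K\<ge>0. \<forall>t\<in>S. \<bar>f t\<bar> \<le> K \<and> \<bar>h t\<bar> \<le> K \<and> \<bar>f t - h t\<bar> \<le> K * e t)"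

text \<open>The three bounds may be found separately and carry no sign condition; the sum of their
  absolute values serves as the common constant.\<close>

lemma comparableI:
  assumes "\<And>t. t \<in> S \<Longrightarrow> \<bar>f t\<bar> \<le> K1" "\<And>t. t \<in> S \<Longrightarrow> \<bar>h t\<bar> \<le> K2"
    and "\<And>t. t \<in> S \<Longrightarrow> \<bar>f t - h t\<bar> \<le> K3 * e t" and e: "\<And>t. t \<in> S \<Longrightarrow> e t \<ge> 0"
  shows "comparable S e f h"
  unfolding comparable_def
proof (intro exI conjI ballI)
  let ?K = "\<bar>K1\<bar> + \<bar>K2\<bar> + \<bar>K3\<bar>"
  show "?K \<ge> 0" by simp
  fix t assume t: "t \<in> S"
  show "\<bar>f t\<bar> \<le> ?K" "\<bar>h t\<bar> \<le> ?K" using assms(1,2)[OF t] by linarith+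
  have "K3 * e t \<le> ?K * e t" by (rule mult_right_mono) (use e[OF t] in auto)
  then show "\<bar>f t - h t\<bar> \<le> ?K * e t" using assms(3)[OF t] by linarith
qed

lemma comparable_const:
  assumes "\<And>t. t \<in> S \<Longrightarrow> e t \<ge> 0"
  shows "comparable S e (\<lambda>t. k) (\<lambda>t. k)"
  by (rule comparableI[of _ _ "\<bar>k\<bar>" _ "\<bar>k\<bar>" 0]) (use assms in auto)

lemma comparable_add:
  assumes e: "\<And>t. t \<in> S \<Longrightarrow> e t \<ge> 0" and "comparable S e f h" "comparable S e f' h'"
  shows "comparable S e (\<lambda>t. f t + f' t) (\<lambda>t. h t + h' t)"
proof -
  obtain K K' where
    K: "\<And>t. t \<in> S \<Longrightarrow> \<bar>f t\<bar> \<le> K \<and> \<bar>h t\<bar> \<le> K \<and> \<bar>f t - h t\<bar> \<le> K * e t" and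
    K': "\<And>t. t \<in> S \<Longrightarrow> \<bar>f' t\<bar> \<le> K' \<and> \<bar>h' t\<bar> \<le> K' \<and> \<bar>f' t - h' t\<bar> \<le> K' * e t"
    using assms(2,3) unfolding comparable_def by metis
  show ?thesis
  proof (rule comparableI[of _ _ "K + K'" _ "K + K'" "K + K'"])
    fix t assume t: "t \<in> S"
    show "\<bar>f t + f' t\<bar> \<le> K + K'" "\<bar>h t + h' t\<bar> \<le> K + K'"
      using K[OF t] K'[OF t] by linarith+
    show "\<bar>f t + f' t - (h t + h' t)\<bar> \<le> (K + K') * e t"
      using K[OF t] K'[OF t] unfolding distrib_right by linarith
  qed (use e in auto)
qed

text \<open>The difference of the products telescopes through \<open>f t * h' t\<close>. The uniform
  bounds in \<open>comparable\<close> are there to control the undifferenced factors.\<close>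

lemma comparable_mult:
  assumes e: "\<And>t. t \<in> S \<Longrightarrow> e t \<ge> 0" and "comparable S e f h" "comparable S e f' h'"
  shows "comparable S e (\<lambda>t. f t * f' t) (\<lambda>t. h t * h' t)"
proof -
  obtain K K' where p: "K \<ge> 0" "K' \<ge> 0" and
    K: "\<And>t. t \<in> S \<Longrightarrow> \<bar>f t\<bar> \<le> K \<and> \<bar>h t\<bar> \<le> K \<and> \<bar>f t - h t\<bar> \<le> K * e t" and
    K': "\<And>t. t \<in> S \<Longrightarrow> \<bar>f' t\<bar> \<le> K' \<and> \<bar>h' t\<bar> \<le> K' \<and> \<bar>f' t - h' t\<bar> \<le> K' * e t"
    using assms(2,3) unfolding comparable_def by metis
  show ?thesis
  proof (rule comparableI[of _ _ "K * K'" _ "K * K'" "2 * K * K'"])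
    fix t assume t: "t \<in> S"
    show "\<bar>f t * f' t\<bar> \<le> K * K'" "\<bar>h t * h' t\<bar> \<le> K * K'"
      using K[OF t] K'[OF t] p by (auto simp: abs_mult intro!: mult_mono)
    have "f t * f' t - h t * h' t = f t * (f' t - h' t) + (f t - h t) * h' t"
      by (simp add: algebra_simps)
    also have "\<bar>\<dots>\<bar> \<le> \<bar>f t\<bar> * \<bar>f' t - h' t\<bar> + \<bar>f t - h t\<bar> * \<bar>h' t\<bar>"
      by (metis abs_mult abs_triangle_ineq)
    also have "\<dots> \<le> K * (K' * e t) + (K * e t) * K'"
      using K[OF t] K'[OF t] p e[OF t] by (intro add_mono mult_mono) auto
    finally show "\<bar>f t * f' t - h t * h' t\<bar> \<le> 2 * K * K' * e t" by (simp add: algebra_simps)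
  qed (use e in auto)
qed

lemma comparable_sum:
  assumes e: "\<And>t. t \<in> S \<Longrightarrow> e t \<ge> 0" and "\<And>i. i \<in> I \<Longrightarrow> comparable S e (f i) (h i)"
  shows "comparable S e (\<lambda>t. \<Sum>i\<in>I. f i t) (\<lambda>t. \<Sum>i\<in>I. h i t)"
  using assms(2)
\<comment> \<open>For infinite \<open>I\<close> both sums are 0 by convention, so this case joins
  the empty one.\<close>
proof (induction I rule: infinite_finite_induct)
  case (insert i I)
  then show ?case using comparable_add[of S e "f i" "h i"] e by simp
qed (use comparable_const[of S e 0] e in auto)

lemma bounded_on_interval:
  fixes f :: "real \<Rightarrow> 'b::real_normed_vector"
  assumes "continuous_on {s..r} f"
  shows "\<exists>B. \<forall>t\<in>{s..r}. norm (f t) \<le> B"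
  using compact_imp_bounded[OF compact_continuous_image[OF assms compact_Icc]]
  by (auto simp: bounded_iff)

lemma comparable_cong:
  assumes "comparable S e f h" "\<And>t. t \<in> S \<Longrightarrow> f' t = f t" "\<And>t. t \<in> S \<Longrightarrow> h' t = h t"
  shows "comparable S e f' h'"
  using assms by (simp add: comparable_def)

text \<open>The entry point of smoothness: the Lipschitz bound on \<open>K\<close> turns a bound on
  the distance of the base points into one on the values of \<open>f\<close>.\<close>

lemma comparable_smooth:
  fixes f :: "'a::euclidean_space \<Rightarrow> real"
  assumes f: "smooth_on S f" and K: "compact K" "convex K" "K \<subseteq> S"
    and ab: "\<And>t. t \<in> T \<Longrightarrow> a t \<in> K" "\<And>t. t \<in> T \<Longrightarrow> b t \<in> K"
    and e: "\<And>t. t \<in> T \<Longrightarrow> norm (a t - b t) \<le> e t"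
  shows "comparable T e (\<lambda>t. f (a t)) (\<lambda>t. f (b t))"
proof -
  obtain L where L: "L \<ge> 0" "\<And>x y. x \<in> K \<Longrightarrow> y \<in> K \<Longrightarrow> \<bar>f x - f y\<bar> \<le> L * norm (x - y)"
    using smooth_on_lipschitz[OF f K] by blast
  have "bounded (f ` K)"
    using continuous_on_subset[OF smooth_on_continuous[OF f] K(3)] K(1)
      compact_continuous_image compact_imp_bounded by blast
  then obtain B where B: "\<And>x. x \<in> K \<Longrightarrow> \<bar>f x\<bar> \<le> B" by (auto simp: bounded_iff)
  show ?thesis
  proof (rule comparableI[of _ _ B _ B L])
    fix t assume t: "t \<in> T"
    show "\<bar>f (a t)\<bar> \<le> B" "\<bar>f (b t)\<bar> \<le> B" using B ab t by auto
    show "\<bar>f (a t) - f (b t)\<bar> \<le> L * e t"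
      using L(2)[OF ab(1)[OF t] ab(2)[OF t]] mult_left_mono[OF e[OF t] L(1)] by linarith
    show "e t \<ge> 0" using e[OF t] norm_ge_zero order_trans by blast
  qed
qed

text \<open>The times spent in a chart form a relatively open subset of \<open>I\<close>.
  Derivatives within this set, as in \<open>smooth_curve_on\<close>, are therefore derivatives
  within \<open>I\<close>.\<close>

lemma at_within_preimage:
  fixes \<gamma> :: "real \<Rightarrow> 'm::topological_space"
  assumes "continuous_on I \<gamma>" "open U" "t \<in> I" "\<gamma> t \<in> U"
  shows "at t within {t\<in>I. \<gamma> t \<in> U} = at t within I"
proof -
  obtain S where S: "open S" "S \<inter> I = \<gamma> -` U \<inter> I"
    using assms(1,2) unfolding continuous_on_open_invariant by blast
  show ?thesis
    by (rule at_within_nhd[of t S]) (use S assms(3,4) in auto)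
qed

section \<open>The metric and the Christoffel map in charts\<close>

locale riemannian =
  fixes A :: "('m::{t2_space, second_countable_topology}, 'e::euclidean_space) chart set"
    and g :: "'m \<Rightarrow> 'e \<Rightarrow> 'e \<Rightarrow> real"
  assumes manifold: "riemannian_manifold A g"
begin

lemma metric_inner_product: "is_inner_product (g x)"
  using manifold by (simp add: riemannian_manifold_def)

lemma chart_at_mem: "chart_at A x \<in> A" "x \<in> fst (chart_at A x)"
proof -
  have "\<exists>c. c \<in> A \<and> x \<in> fst c"
    using manifold unfolding riemannian_manifold_def smooth_atlas_def by blast
  from someI_ex[OF this] show "chart_at A x \<in> A" "x \<in> fst (chart_at A x)"
    by (simp_all add: chart_at_def)
qed

context
  fixes c :: "('m, 'e) chart"
  assumes c: "c \<in> A"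
begin

lemma is_chart: "is_chart c"
  using manifold c by (auto simp: riemannian_manifold_def smooth_atlas_def)

lemma open_chart: "open (fst c)" "open (snd c ` fst c)"
  using is_chart by (auto simp: is_chart_def)

lemma continuous_chart: "continuous_on (fst c) (snd c)" "continuous_on (snd c ` fst c) (chart_inv c)"
  using is_chart by (auto simp: is_chart_def homeomorphism_def)

lemma chart_inv_chart: "x \<in> fst c \<Longrightarrow> chart_inv c (snd c x) = x"
  using is_chart by (auto simp: is_chart_def homeomorphism_def)

lemma chart_inv_mem: "p \<in> snd c ` fst c \<Longrightarrow> chart_inv c p \<in> fst c"
  using is_chart by (auto simp: is_chart_def homeomorphism_def)

lemma open_overlap:
  assumes "open V"
  shows "open (snd c ` (fst c \<inter> V))"
proof -
  have "snd c ` (fst c \<inter> V) = chart_inv c -` V \<inter> (snd c ` fst c)"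
    using chart_inv_chart by (force simp: image_iff)
  then show ?thesis
    using continuous_chart(2) continuous_on_open_vimage[OF open_chart(2)] assms by metis
qed

lemma transition_differentiable:
  assumes "d \<in> A" "x \<in> fst c" "x \<in> fst d"
  shows "(snd d \<circ> chart_inv c) differentiable (at (snd c x))"
proof (rule smooth_on_differentiable)
  show "smooth_on (snd c ` (fst c \<inter> fst d)) (snd d \<circ> chart_inv c)"
    using manifold c assms(1) by (auto simp: riemannian_manifold_def smooth_atlas_def)
qed (use assms in auto)

lemma linear_tangent_of_coords:
  assumes "x \<in> fst c"
  shows "linear (tangent_of_coords A c x)"
  using linear_frechet_derivative[OF transition_differentiable[OF chart_at_mem(1) assms chart_at_mem(2)]]
  by (simp add: tangent_of_coords_def[abs_def])

end

text \<open>The derivative of the reverse coordinate change is a left inverse, by the chain rule.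
  This injectivity makes the metric definite in every chart.\<close>

lemma tangent_of_coords_eq_0:
  assumes c: "c \<in> A" "x \<in> fst c" and u: "tangent_of_coords A c x u = 0"
  shows "u = 0"
proof -
  let ?d = "chart_at A x"
  let ?f = "snd ?d \<circ> chart_inv c" and ?h = "snd c \<circ> chart_inv ?d"
  have fx: "?f (snd c x) = snd ?d x" using chart_inv_chart[OF c] by simp
  have f: "(?f has_derivative frechet_derivative ?f (at (snd c x))) (at (snd c x))"
    using transition_differentiable[OF c(1) chart_at_mem(1) c(2) chart_at_mem(2)] frechet_derivative_works
    by blast
  have h: "(?h has_derivative frechet_derivative ?h (at (snd ?d x))) (at (?f (snd c x)))"
    using transition_differentiable[OF chart_at_mem(1) c(1) chart_at_mem(2) c(2)] frechet_derivative_works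
    unfolding fx by blast
  have "((?h \<circ> ?f) has_derivative
      (frechet_derivative ?h (at (snd ?d x)) \<circ> frechet_derivative ?f (at (snd c x)))) (at (snd c x))"
    using diff_chain_at[OF f h] .
  \<comment> \<open>The composite is the identity only on the chart overlap, but this is an open
    neighbourhood of the point.\<close>
  then have "((\<lambda>p. p) has_derivative
      (frechet_derivative ?h (at (snd ?d x)) \<circ> frechet_derivative ?f (at (snd c x)))) (at (snd c x))"
  proof (rule has_derivative_transform_within_open)
    show "open (snd c ` (fst c \<inter> fst ?d))"
      using open_overlap[OF c(1)] open_chart(1)[OF chart_at_mem(1)] by blast
    show "snd c x \<in> snd c ` (fst c \<inter> fst ?d)" using c(2) chart_at_mem(2) by auto
    show "(?h \<circ> ?f) p = p" if "p \<in> snd c ` (fst c \<inter> fst ?d)" for p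
      using that chart_inv_chart[OF c(1)] chart_inv_chart[OF chart_at_mem(1)] by auto
  qed
  moreover have "((\<lambda>p. p) has_derivative (\<lambda>p. p)) (at (snd c x))" by simp
  ultimately have "frechet_derivative ?h (at (snd ?d x)) \<circ> frechet_derivative ?f (at (snd c x)) = (\<lambda>p. p)"
    by (rule has_derivative_unique)
  then have "frechet_derivative ?h (at (snd ?d x)) (tangent_of_coords A c x u) = u"
    unfolding tangent_of_coords_def by (metis comp_apply)
  moreover have "linear (frechet_derivative ?h (at (snd ?d x)))"
    using has_derivative_linear[OF h] .
  ultimately show ?thesis using u by (simp add: linear_0)
qed

text \<open>The local metric is the pullback of \<open>g\<close> along the linear injective map
  \<open>tangent_of_coords\<close>.\<close>

lemma local_metric_inner_product:
  assumes c: "c \<in> A" and p: "p \<in> snd c ` fst c"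
  shows "is_inner_product (local_metric A g c p)"
proof -
  let ?x = "chart_inv c p"
  have x: "?x \<in> fst c" using chart_inv_mem[OF c p] .
  have lin: "linear (tangent_of_coords A c ?x)" using linear_tangent_of_coords[OF c x] .
  have bil: "bilinear (g ?x)" and sym: "\<And>u v. g ?x u v = g ?x v u" and
    pos: "\<And>u. u \<noteq> 0 \<Longrightarrow> g ?x u u > 0"
    using metric_inner_product[of ?x] by (auto simp: is_inner_product_def)
  have "bilinear (local_metric A g c p)"
    unfolding bilinear_def
    by (auto intro!: linearI simp: local_metric_def linear_add[OF lin] linear_cmul[OF lin]
      bilinear_ladd[OF bil] bilinear_radd[OF bil] bilinear_lmul[OF bil] bilinear_rmul[OF bil])
  moreover have "local_metric A g c p u u > 0" if "u \<noteq> 0" for u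
    using pos tangent_of_coords_eq_0[OF c x] that by (auto simp: local_metric_def)
  ultimately show ?thesis
    using sym by (auto simp: is_inner_product_def local_metric_def)
qed

text \<open>Separates the smooth scalar coefficients, which depend on \<open>p\<close> only, from
  the vectors, which enter polynomially. Continuity and Lipschitz questions reduce to the
  coefficients.\<close>

lemma local_metric_expand:
  assumes c: "c \<in> A" and p: "p \<in> snd c ` fst c"
  shows "local_metric A g c p u v
    = (\<Sum>i\<in>Basis. \<Sum>j\<in>Basis. (u \<bullet> i) * (v \<bullet> j) * local_metric A g c p i j)"
proof -
  have bil: "bilinear (local_metric A g c p)"
    using local_metric_inner_product[OF c p] by (simp add: is_inner_product_def)
  have "local_metric A g c p u v
      = local_metric A g c p (\<Sum>i\<in>Basis. (u \<bullet> i) *\<^sub>R i) (\<Sum>j\<in>Basis. (v \<bullet> j) *\<^sub>R j)"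
    by (simp add: euclidean_representation)
  also have "\<dots> = (\<Sum>(i,j)\<in>Basis \<times> Basis. (u \<bullet> i) * (v \<bullet> j) * local_metric A g c p i j)"
    by (subst bilinear_sum[OF bil])
       (simp add: bilinear_lmul[OF bil] bilinear_rmul[OF bil] mult_ac)
  finally show ?thesis by (simp add: sum.cartesian_product mult_ac)
qed

lemma local_metric_smooth:
  "c \<in> A \<Longrightarrow> smooth_on (snd c ` fst c) (\<lambda>p. local_metric A g c p u v)"
  using manifold by (simp add: riemannian_manifold_def)

text \<open>The direction of differentiation comes before the two metric arguments: on basis
  vectors, \<open>dmetric c p k i j\<close> is the partial derivative in direction \<open>k\<close>
  of the coefficient with indices \<open>i\<close> and \<open>j\<close>.\<close>

definition dmetric :: "('m, 'e) chart \<Rightarrow> 'e \<Rightarrow> 'e \<Rightarrow> 'e \<Rightarrow> 'e \<Rightarrow> real" where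
  "dmetric c p h u v = frechet_derivative (\<lambda>q. local_metric A g c q u v) (at p) h"

lemma local_metric_has_derivative:
  assumes "c \<in> A" "p \<in> snd c ` fst c"
  shows "((\<lambda>q. local_metric A g c q u v) has_derivative (\<lambda>h. dmetric c p h u v)) (at p)"
  using smooth_on_differentiable[OF local_metric_smooth[OF assms(1)] assms(2)]
  by (simp add: dmetric_def frechet_derivative_works)

text \<open>Differentiating the finite expansion of the metric, valid on the open chart image, gives
  the dependence on \<open>u\<close> and \<open>v\<close>; linearity of the derivative gives that on
  \<open>h\<close>.\<close>

lemma dmetric_expand:
  assumes c: "c \<in> A" and p: "p \<in> snd c ` fst c"
  shows "dmetric c p h u v = (\<Sum>i\<in>Basis. \<Sum>j\<in>Basis. \<Sum>k\<in>Basis.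
    (u \<bullet> i) * (v \<bullet> j) * (h \<bullet> k) * dmetric c p k i j)"
proof -
  have "((\<lambda>q. \<Sum>i\<in>Basis. \<Sum>j\<in>Basis. (u \<bullet> i) * (v \<bullet> j) * local_metric A g c q i j) has_derivative
      (\<lambda>h. \<Sum>i\<in>Basis. \<Sum>j\<in>Basis. (u \<bullet> i) * (v \<bullet> j) * dmetric c p h i j)) (at p)"
    by (intro has_derivative_sum has_derivative_mult_right local_metric_has_derivative c p)
  then have "((\<lambda>q. local_metric A g c q u v) has_derivative
      (\<lambda>h. \<Sum>i\<in>Basis. \<Sum>j\<in>Basis. (u \<bullet> i) * (v \<bullet> j) * dmetric c p h i j)) (at p)"
    by (rule has_derivative_transform_within_open[OF _ open_chart(2)[OF c] p])
       (simp add: local_metric_expand[OF c, of _ u v])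
  from has_derivative_unique[OF local_metric_has_derivative[OF c p] this]
  have "dmetric c p h u v = (\<Sum>i\<in>Basis. \<Sum>j\<in>Basis. (u \<bullet> i) * (v \<bullet> j) * dmetric c p h i j)"
    by meson
  moreover have "dmetric c p h i j = (\<Sum>k\<in>Basis. (h \<bullet> k) * dmetric c p k i j)" for i j
  proof -
    have lin: "linear (\<lambda>h. dmetric c p h i j)"
      using has_derivative_linear[OF local_metric_has_derivative[OF c p]] .
    have "dmetric c p h i j = dmetric c p (\<Sum>k\<in>Basis. (h \<bullet> k) *\<^sub>R k) i j"
      by (simp add: euclidean_representation)
    then show ?thesis by (simp add: linear_sum[OF lin] linear_cmul[OF lin])
  qed
  ultimately show ?thesis
    by (simp add: sum_distrib_left mult.assoc)
qed

text \<open>The Koszul formula of \<open>christoffel\<close> on the diagonal \<open>u = v\<close>, where it is the only value that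
  enters the geodesic equation.\<close>

definition koszul :: "('m, 'e) chart \<Rightarrow> 'e \<Rightarrow> 'e \<Rightarrow> 'e \<Rightarrow> real" where
  "koszul c p u w = (dmetric c p u u w + dmetric c p u u w - dmetric c p w u u) / 2"

text \<open>The Koszul expression is linear in \<open>w\<close>, so exactly one vector represents it
  and the definite description in \<open>christoffel\<close> denotes that vector.\<close>

lemma christoffel_koszul:
  assumes c: "c \<in> A" and p: "p \<in> snd c ` fst c"
  shows "local_metric A g c p (christoffel A g c p u u) w = koszul c p u w"
proof -
  have "linear (koszul c p u)"
  proof (rule linearI)
    fix w w' and r :: real
    have "dmetric c p h u (w + w') = dmetric c p h u w + dmetric c p h u w'"
      "dmetric c p (w + w') u h = dmetric c p w u h + dmetric c p w' u h"
      "dmetric c p h u (r *\<^sub>R w) = r * dmetric c p h u w"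
      "dmetric c p (r *\<^sub>R w) u h = r * dmetric c p w u h" for h
      unfolding dmetric_expand[OF c p, of _ u]
      by (simp_all add: inner_add_left algebra_simps sum.distrib sum_distrib_left)
    then show "koszul c p u (w + w') = koszul c p u w + koszul c p u w'"
      "koszul c p u (r *\<^sub>R w) = r *\<^sub>R koszul c p u w"
      by (simp_all add: koszul_def field_simps)
  qed
  then have "\<exists>!z. \<forall>w. local_metric A g c p z w = koszul c p u w"
    by (rule inner_product_represents[OF local_metric_inner_product[OF c p]])
  from theI'[OF this] show ?thesis
    by (simp add: christoffel_def koszul_def dmetric_def)
qed

text \<open>The Koszul expression is quadratic in \<open>u\<close>, and definiteness carries this
  over to the representing vector. Needed for reparametrisation and, with \<open>r = 0\<close>, for
  constant curves.\<close>

lemma christoffel_scale: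
  assumes c: "c \<in> A" and p: "p \<in> snd c ` fst c"
  shows "christoffel A g c p (r *\<^sub>R u) (r *\<^sub>R u) = r\<^sup>2 *\<^sub>R christoffel A g c p u u"
proof -
  have ip: "is_inner_product (local_metric A g c p)" using local_metric_inner_product[OF c p] .
  then have bil: "bilinear (local_metric A g c p)" by (simp add: is_inner_product_def)
  have "koszul c p (r *\<^sub>R u) w = r\<^sup>2 * koszul c p u w" for w
  proof -
    have "dmetric c p (r *\<^sub>R u) (r *\<^sub>R u) w = r\<^sup>2 * dmetric c p u u w"
      "dmetric c p w (r *\<^sub>R u) (r *\<^sub>R u) = r\<^sup>2 * dmetric c p w u u"
      unfolding dmetric_expand[OF c p, of _ "r *\<^sub>R u"] dmetric_expand[OF c p, of _ u]
      by (simp_all add: sum_distrib_left power2_eq_square mult_ac)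
    then show ?thesis by (simp add: koszul_def algebra_simps)
  qed
  then have *: "local_metric A g c p (christoffel A g c p (r *\<^sub>R u) (r *\<^sub>R u)) w
      = local_metric A g c p (r\<^sup>2 *\<^sub>R christoffel A g c p u u) w" for w
    by (simp add: christoffel_koszul[OF c p] bilinear_lmul[OF bil])
  define z where "z = christoffel A g c p (r *\<^sub>R u) (r *\<^sub>R u) - r\<^sup>2 *\<^sub>R christoffel A g c p u u"
  have "local_metric A g c p z z = 0" using * by (simp add: z_def bilinear_lsub[OF bil])
  then have "z = 0" using ip by (force simp: is_inner_product_def)
  then show ?thesis by (simp add: z_def)
qed

section \<open>Curves and geodesics in charts\<close>

text \<open>Velocity in one fixed chart. Unlike \<open>velocity\<close>, whose preferred chart may
  jump from point to point, it can be differentiated along the curve.\<close>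

definition cvel :: "('m, 'e) chart \<Rightarrow> (real \<Rightarrow> 'm) \<Rightarrow> real \<Rightarrow> 'e" where
  "cvel c \<gamma> t = vector_derivative (snd c \<circ> \<gamma>) (at t within {0..1})"

text \<open>Translates the derivative family \<open>D\<close> of a smooth curve into the
  \<open>vector_derivative\<close> terms of velocity and acceleration; derivatives within
  \<open>{0..1}\<close> are unique, so these terms have the expected values.\<close>

lemma chart_derivatives:
  assumes c: "c \<in> A" and cont: "continuous_on {0..1} \<gamma>"
    and D: "\<forall>t\<in>{t\<in>{0..1}. \<gamma> t \<in> fst c}. D 0 t = snd c (\<gamma> t) \<and>
        (\<forall>k::nat. (D k has_vector_derivative D (Suc k) t) (at t within {t\<in>{0..1}. \<gamma> t \<in> fst c}))"
    and t: "t \<in> {0..1}" "\<gamma> t \<in> fst c"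
  shows "(D k has_vector_derivative D (Suc k) t) (at t within {0..1})"
    and "((snd c \<circ> \<gamma>) has_vector_derivative D 1 t) (at t within {0..1})"
    and "cvel c \<gamma> t = D 1 t"
    and "(cvel c \<gamma> has_vector_derivative D 2 t) (at t within {0..1})"
    and "covariant_acceleration A g c \<gamma> t
      = D 2 t + christoffel A g c (snd c (\<gamma> t)) (D 1 t) (D 1 t)"
proof -
  let ?J = "{t\<in>{0..1}. \<gamma> t \<in> fst c}"
  have at: "at t within ?J = at t within {0..1}" if "t \<in> {0..1}" "\<gamma> t \<in> fst c" for t
    using at_within_preimage[OF cont open_chart(1)[OF c] that] .
  have DJ: "(D k has_vector_derivative D (Suc k) t) (at t within ?J)" if "t \<in> ?J" for t k
    using D that by blast
  show Dk: "(D k has_vector_derivative D (Suc k) t) (at t within {0..1})" for k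
    using DJ[of t k] t at by simp
  \<comment> \<open>Proved for all times spent in the chart: the second derivative differentiates
    \<open>cvel\<close>, whose values near the fixed time are needed.\<close>
  have pos: "((snd c \<circ> \<gamma>) has_vector_derivative D 1 t) (at t within {0..1})"
    if t: "t \<in> {0..1}" "\<gamma> t \<in> fst c" for t
  proof -
    have "((snd c \<circ> \<gamma>) has_vector_derivative D 1 t) (at t within ?J)"
      by (rule has_vector_derivative_transform[of _ _ _ "D 0"]) (use DJ[of t 0] t D in auto)
    then show ?thesis using at[OF t] by simp
  qed
  then show "((snd c \<circ> \<gamma>) has_vector_derivative D 1 t) (at t within {0..1})" using t .
  have vel: "cvel c \<gamma> t = D 1 t" if "t \<in> {0..1}" "\<gamma> t \<in> fst c" for t
    unfolding cvel_def
    by (rule vector_derivative_within_closed_interval) (use pos[OF that] that in auto)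
  then show "cvel c \<gamma> t = D 1 t" using t .
  have "(cvel c \<gamma> has_vector_derivative D 2 t) (at t within ?J)"
    by (rule has_vector_derivative_transform[of _ _ _ "D 1"])
       (use DJ[of t 1] t vel in \<open>auto simp: numeral_2_eq_2\<close>)
  then show acc: "(cvel c \<gamma> has_vector_derivative D 2 t) (at t within {0..1})"
    using at[OF t] by simp
  have "vector_derivative (cvel c \<gamma>) (at t within {0..1}) = D 2 t"
    by (rule vector_derivative_within_closed_interval) (use acc t in auto)
  then show "covariant_acceleration A g c \<gamma> t
      = D 2 t + christoffel A g c (snd c (\<gamma> t)) (D 1 t) (D 1 t)"
    using vel[OF t] by (simp add: covariant_acceleration_def Let_def cvel_def[abs_def])
qed

lemma has_vector_derivative_cvel:
  assumes "smooth_curve_on A {0..1} \<gamma>" and c: "c \<in> A" and t: "t \<in> {0..1}" "\<gamma> t \<in> fst c"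
  shows "((snd c \<circ> \<gamma>) has_vector_derivative cvel c \<gamma> t) (at t within {0..1})"
proof -
  have cont: "continuous_on {0..1} \<gamma>" using assms(1) by (simp add: smooth_curve_on_def)
  obtain D where D: "\<forall>t\<in>{t\<in>{0..1}. \<gamma> t \<in> fst c}. D 0 t = snd c (\<gamma> t) \<and>
        (\<forall>k::nat. (D k has_vector_derivative D (Suc k) t) (at t within {t\<in>{0..1}. \<gamma> t \<in> fst c}))"
    using assms(1) c unfolding smooth_curve_on_def by blast
  show ?thesis using chart_derivatives(2,3)[OF c cont D t] by simp
qed

text \<open>Chain rule for the passage from \<open>c\<close> to the preferred chart at
  \<open>\<gamma> t\<close>.\<close>

lemma velocity_chart:
  assumes c: "c \<in> A" and cont: "continuous_on {0..1} \<gamma>" and t: "t \<in> {0..1}" "\<gamma> t \<in> fst c"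
    and u: "((snd c \<circ> \<gamma>) has_vector_derivative u) (at t within {0..1})"
  shows "velocity A \<gamma> t = tangent_of_coords A c (\<gamma> t) u"
proof -
  let ?d = "chart_at A (\<gamma> t)"
  let ?J = "{t\<in>{0..1}. \<gamma> t \<in> fst c}"
  have at: "at t within ?J = at t within {0..1}"
    using at_within_preimage[OF cont open_chart(1)[OF c] t] .
  have "((snd ?d \<circ> chart_inv c) has_derivative tangent_of_coords A c (\<gamma> t)) (at ((snd c \<circ> \<gamma>) t))"
    using transition_differentiable[OF c chart_at_mem(1) t(2) chart_at_mem(2)]
    by (simp add: frechet_derivative_works tangent_of_coords_def[abs_def])
  then have "((snd ?d \<circ> chart_inv c) has_derivative tangent_of_coords A c (\<gamma> t))
      (at ((snd c \<circ> \<gamma>) t) within (snd c \<circ> \<gamma>) ` ?J)"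
    by (rule has_derivative_at_withinI)
  from vector_derivative_diff_chain_within[OF u[folded at] this]
  have "((snd ?d \<circ> \<gamma>) has_vector_derivative tangent_of_coords A c (\<gamma> t) u) (at t within ?J)"
    by (rule has_vector_derivative_transform[rotated 2])
       (use t chart_inv_chart[OF c] in auto)
  then show ?thesis
    unfolding velocity_def at
    by (intro vector_derivative_within_closed_interval) (use t in auto)
qed

section \<open>Speed and length of curves\<close>

lemma continuous_on_local_metric:
  assumes c: "c \<in> A" and p: "continuous_on S p" "p ` S \<subseteq> snd c ` fst c"
    and u: "continuous_on S u" and v: "continuous_on S v"
  shows "continuous_on S (\<lambda>t. local_metric A g c (p t) (u t) (v t))"
proof -
  have 1: "continuous_on S (\<lambda>t. local_metric A g c (p t) i j)" for i j
    using continuous_on_compose2[OF smooth_on_continuous[OF local_metric_smooth[OF c]] p(1,2)] .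
  have "continuous_on S (\<lambda>t. \<Sum>i\<in>Basis. \<Sum>j\<in>Basis. (u t \<bullet> i) * (v t \<bullet> j) * local_metric A g c (p t) i j)"
    by (intro continuous_intros u v 1)
  then show ?thesis
    by (rule continuous_on_eq) (use p(2) in \<open>auto simp: local_metric_expand[OF c, symmetric]\<close>)
qed

text \<open>The coordinates of \<open>velocity\<close> may jump with the preferred chart, but the
  speed does not depend on the chart. Near each time it is computed in the chart fixed at that
  time.\<close>

lemma continuous_on_speed:
  assumes \<gamma>: "smooth_curve_on A {0..1} \<gamma>"
  shows "continuous_on {0..1} (\<lambda>t. ip_norm (g (\<gamma> t)) (velocity A \<gamma> t))"
  unfolding continuous_on_eq_continuous_within
proof
  fix t :: real assume t: "t \<in> {0..1}"
  let ?c = "chart_at A (\<gamma> t)"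
  let ?J = "{t\<in>{0..1}. \<gamma> t \<in> fst ?c}"
  have c: "?c \<in> A" "\<gamma> t \<in> fst ?c" using chart_at_mem by auto
  have cont: "continuous_on {0..1} \<gamma>" using \<gamma> by (simp add: smooth_curve_on_def)
  obtain D where D: "\<forall>t\<in>?J. D 0 t = snd ?c (\<gamma> t) \<and>
        (\<forall>k::nat. (D k has_vector_derivative D (Suc k) t) (at t within ?J))"
    using \<gamma> c(1) unfolding smooth_curve_on_def by blast
  note der = chart_derivatives[OF c(1) cont D]
  have contD: "continuous_on ?J (D k)" for k
    using D by (intro continuous_on_vector_derivative) blast
  have "continuous_on ?J (\<lambda>s. sqrt (local_metric A g ?c (D 0 s) (D 1 s) (D 1 s)))"
    by (intro continuous_on_real_sqrt continuous_on_local_metric c contD) (use D in auto)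
  moreover have "sqrt (local_metric A g ?c (D 0 s) (D 1 s) (D 1 s)) = ip_norm (g (\<gamma> s)) (velocity A \<gamma> s)"
    if s: "s \<in> ?J" for s
  proof -
    have "velocity A \<gamma> s = tangent_of_coords A ?c (\<gamma> s) (D 1 s)"
      using velocity_chart[OF c(1) cont] der(2) s by auto
    then show ?thesis
      using D s chart_inv_chart[OF c(1)] by (auto simp: local_metric_def ip_norm_def)
  qed
  ultimately have "continuous_on ?J (\<lambda>s. ip_norm (g (\<gamma> s)) (velocity A \<gamma> s))"
    by (rule continuous_on_eq)
  then have "continuous (at t within ?J) (\<lambda>s. ip_norm (g (\<gamma> s)) (velocity A \<gamma> s))"
    using t c(2) by (simp add: continuous_on_eq_continuous_within)
  then show "continuous (at t within {0..1}) (\<lambda>s. ip_norm (g (\<gamma> s)) (velocity A \<gamma> s))"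
    using at_within_preimage[OF cont open_chart(1)[OF c(1)] t c(2)] by simp
qed

lemma metric_zero: "g x 0 0 = 0"
  using metric_inner_product[of x] bilinear_lzero unfolding is_inner_product_def by blast

lemma metric_pos: "v \<noteq> 0 \<Longrightarrow> g x v v > 0"
  using metric_inner_product[of x] unfolding is_inner_product_def by blast

lemma ip_norm_nonneg: "ip_norm (g x) v \<ge> 0"
  using metric_zero metric_pos[of v x] by (cases "v = 0") (simp_all add: ip_norm_def)

lemma ip_norm_eq_0: "ip_norm (g x) v = 0 \<longleftrightarrow> v = 0"
  using metric_zero metric_pos[of v x] by (cases "v = 0") (simp_all add: ip_norm_def)

text \<open>A speed that is not integrable has integral 0 by convention, so the bound covers
  arbitrary curves.\<close>

lemma curve_length_nonneg: "curve_length A g \<gamma> \<ge> 0"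
proof (cases "(\<lambda>t. ip_norm (g (\<gamma> t)) (velocity A \<gamma> t)) integrable_on {0..1}")
  case True
  then show ?thesis unfolding curve_length_def by (rule integral_nonneg) (simp add: ip_norm_nonneg)
qed (simp add: curve_length_def not_integrable_integral)

lemma velocity_eq_0_if_length_0:
  assumes "smooth_curve_on A {0..1} \<gamma>" "curve_length A g \<gamma> = 0" "t \<in> {0..1}"
  shows "velocity A \<gamma> t = 0"
proof -
  have "ip_norm (g (\<gamma> t)) (velocity A \<gamma> t) = 0"
    using integral_eq_0_iff[OF continuous_on_speed[OF assms(1)]] assms(2,3) ip_norm_nonneg
    by (auto simp: curve_length_def)
  then show ?thesis by (simp add: ip_norm_eq_0)
qed

lemma velocity_const: "t \<in> {0..1} \<Longrightarrow> velocity A (\<lambda>t. x) t = 0"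
  unfolding velocity_def
  by (rule vector_derivative_within_closed_interval) (simp_all add: o_def)

text \<open>The derivative of order \<open>k\<close> picks up the factor \<open>s ^ k\<close>, and
  the Christoffel term, quadratic in the velocity, picks up the same factor as the second
  derivative. The case \<open>s = 0\<close> gives a constant curve and is included.\<close>

lemma geodesic_scale:
  assumes \<gamma>: "geodesic A g \<gamma>" and s: "s \<in> {0..1}"
  shows "geodesic A g (\<lambda>t. \<gamma> (s * t))" "velocity A (\<lambda>t. \<gamma> (s * t)) 0 = s *\<^sub>R velocity A \<gamma> 0"
proof -
  let ?\<sigma> = "\<lambda>t. \<gamma> (s * t)"
  have smooth: "smooth_curve_on A {0..1} \<gamma>" using \<gamma> by (simp add: geodesic_def)
  then have cont: "continuous_on {0..1} \<gamma>" by (simp add: smooth_curve_on_def)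
  have mem: "s * t \<in> {0..1}" if "t \<in> {0..1}" for t
    using that s by (auto intro: mult_le_one)
  have cont': "continuous_on {0..1} ?\<sigma>"
  proof (rule continuous_on_compose2[OF cont])
    show "continuous_on {0..1} (\<lambda>t. s * t)" by (intro continuous_intros)
  qed (use mem in blast)
  \<comment> \<open>One family \<open>D\<close> is made to serve both curves, so that their
    accelerations can be compared.\<close>
  have D': "\<exists>D. (\<forall>t\<in>{t\<in>{0..1}. \<gamma> t \<in> fst c}. D 0 t = snd c (\<gamma> t) \<and>
        (\<forall>k::nat. (D k has_vector_derivative D (Suc k) t) (at t within {t\<in>{0..1}. \<gamma> t \<in> fst c}))) \<and>
      (\<forall>t\<in>{t\<in>{0..1}. ?\<sigma> t \<in> fst c}. s ^ 0 *\<^sub>R D 0 (s * t) = snd c (?\<sigma> t) \<and>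
        (\<forall>k::nat. ((\<lambda>t. s ^ k *\<^sub>R D k (s * t)) has_vector_derivative s ^ Suc k *\<^sub>R D (Suc k) (s * t))
           (at t within {t\<in>{0..1}. ?\<sigma> t \<in> fst c})))" if c: "c \<in> A" for c
  proof -
    let ?J = "{t\<in>{0..1}. \<gamma> t \<in> fst c}" and ?J' = "{t\<in>{0..1}. ?\<sigma> t \<in> fst c}"
    obtain D where D: "\<forall>t\<in>?J. D 0 t = snd c (\<gamma> t) \<and>
        (\<forall>k::nat. (D k has_vector_derivative D (Suc k) t) (at t within ?J))"
      using smooth c unfolding smooth_curve_on_def by blast
    have "((\<lambda>t. s ^ k *\<^sub>R D k (s * t)) has_vector_derivative s ^ Suc k *\<^sub>R D (Suc k) (s * t))
        (at t within ?J')" if t: "t \<in> ?J'" for t k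
    proof -
      have sub: "(\<lambda>t. s * t) ` ?J' \<subseteq> ?J" using mem by auto
      then have "s * t \<in> ?J" using t by blast
      then have 1: "(D k has_vector_derivative D (Suc k) (s * t)) (at (s * t) within (\<lambda>t. s * t) ` ?J')"
        using D sub has_vector_derivative_within_subset by blast
      have 2: "((\<lambda>t. s * t) has_vector_derivative s) (at t within ?J')"
        by (auto intro!: derivative_eq_intros)
      have "((\<lambda>t. D k (s * t)) has_vector_derivative s *\<^sub>R D (Suc k) (s * t)) (at t within ?J')"
        using vector_diff_chain_within[OF 2 1] by (simp add: o_def)
      then have "((\<lambda>t. s ^ k *\<^sub>R D k (s * t)) has_vector_derivative s ^ k *\<^sub>R s *\<^sub>R D (Suc k) (s * t)) (at t within ?J')"
        by (rule bounded_linear.has_vector_derivative[OF bounded_linear_scaleR_right])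
      then show ?thesis by (simp add: mult.commute)
    qed
    with D mem show ?thesis by (intro exI[of _ D]) auto
  qed
  have acc: "covariant_acceleration A g c ?\<sigma> t = 0 \<and> velocity A ?\<sigma> t = s *\<^sub>R velocity A \<gamma> (s * t)"
    if c: "c \<in> A" and t: "t \<in> {0..1}" "?\<sigma> t \<in> fst c" for c t
  proof -
    obtain D where D: "\<forall>t\<in>{t\<in>{0..1}. \<gamma> t \<in> fst c}. D 0 t = snd c (\<gamma> t) \<and>
        (\<forall>k::nat. (D k has_vector_derivative D (Suc k) t) (at t within {t\<in>{0..1}. \<gamma> t \<in> fst c}))"
      and D': "\<forall>t\<in>{t\<in>{0..1}. ?\<sigma> t \<in> fst c}. s ^ 0 *\<^sub>R D 0 (s * t) = snd c (?\<sigma> t) \<and>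
        (\<forall>k::nat. ((\<lambda>t. s ^ k *\<^sub>R D k (s * t)) has_vector_derivative s ^ Suc k *\<^sub>R D (Suc k) (s * t))
           (at t within {t\<in>{0..1}. ?\<sigma> t \<in> fst c}))"
      using D'[OF c] by blast
    note der = chart_derivatives[OF c cont D mem[OF t(1)] t(2)]
    note der' = chart_derivatives[OF c cont' D' t]
    have p: "snd c (\<gamma> (s * t)) \<in> snd c ` fst c" using t by auto
    have "covariant_acceleration A g c \<gamma> (s * t) = 0"
      using \<gamma> c mem[OF t(1)] t(2) by (auto simp: geodesic_def)
    then have "D 2 (s * t) + christoffel A g c (snd c (\<gamma> (s * t))) (D 1 (s * t)) (D 1 (s * t)) = 0"
      using der(5) by simp
    then have "s\<^sup>2 *\<^sub>R D 2 (s * t) + s\<^sup>2 *\<^sub>R christoffel A g c (snd c (\<gamma> (s * t))) (D 1 (s * t)) (D 1 (s * t)) = 0"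
      by (metis scaleR_right_distrib scaleR_zero_right)
    then have "covariant_acceleration A g c ?\<sigma> t = 0"
      using der'(5) christoffel_scale[OF c p] by simp
    moreover have "velocity A ?\<sigma> t = tangent_of_coords A c (?\<sigma> t) (s *\<^sub>R D 1 (s * t))"
      using velocity_chart[OF c cont' t] der'(2) by simp
    moreover have "velocity A \<gamma> (s * t) = tangent_of_coords A c (?\<sigma> t) (D 1 (s * t))"
      using velocity_chart[OF c cont mem[OF t(1)] t(2) der(2)] .
    ultimately show ?thesis
      using linear_cmul[OF linear_tangent_of_coords[OF c t(2)]] by simp
  qed
  have "smooth_curve_on A {0..1} ?\<sigma>"
    unfolding smooth_curve_on_def
  proof (intro conjI cont' ballI)
    fix c assume "c \<in> A"
    from D'[OF this] obtain D where
      "\<forall>t\<in>{t\<in>{0..1}. ?\<sigma> t \<in> fst c}. s ^ 0 *\<^sub>R D 0 (s * t) = snd c (?\<sigma> t) \<and>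
        (\<forall>k::nat. ((\<lambda>t. s ^ k *\<^sub>R D k (s * t)) has_vector_derivative s ^ Suc k *\<^sub>R D (Suc k) (s * t))
           (at t within {t\<in>{0..1}. ?\<sigma> t \<in> fst c}))" by blast
    then show "\<exists>D. \<forall>t\<in>{t\<in>{0..1}. ?\<sigma> t \<in> fst c}. D 0 t = snd c (?\<sigma> t) \<and>
        (\<forall>k::nat. (D k has_vector_derivative D (Suc k) t) (at t within {t\<in>{0..1}. ?\<sigma> t \<in> fst c}))"
      by (rule exI[of _ "\<lambda>k t. s ^ k *\<^sub>R D k (s * t)"])
  qed
  then show "geodesic A g ?\<sigma>" using acc by (simp add: geodesic_def)
  show "velocity A ?\<sigma> 0 = s *\<^sub>R velocity A \<gamma> 0"
    using acc[OF chart_at_mem(1), of 0 "\<gamma> 0"] chart_at_mem(2) by simp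
qed

section \<open>Uniqueness of geodesics\<close>

text \<open>The quadratic form attains a positive minimum on the compact product of \<open>K\<close>
  with the unit sphere; homogeneity extends the bound to all vectors.\<close>

lemma local_metric_coercive:
  assumes c: "c \<in> A" and K: "compact K" "K \<subseteq> snd c ` fst c"
  obtains l where "l > 0" "\<And>p d. p \<in> K \<Longrightarrow> local_metric A g c p d d \<ge> l * (norm d)\<^sup>2"
proof (cases "K = {}")
  case False
  let ?f = "\<lambda>x. local_metric A g c (fst x) (snd x) (snd x)"
  have "continuous_on (K \<times> sphere 0 1) ?f"
    by (intro continuous_on_local_metric[OF c] continuous_on_fst continuous_on_snd continuous_on_id)
       (use K(2) in auto)
  moreover have "compact (K \<times> sphere (0::'e) 1)" using K(1) by (intro compact_Times compact_sphere)
  moreover have "K \<times> sphere (0::'e) 1 \<noteq> {}" using False by auto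
  ultimately have "\<exists>x\<in>K \<times> sphere 0 1. \<forall>y\<in>K \<times> sphere 0 1. ?f x \<le> ?f y"
    by (intro continuous_attains_inf)
  then obtain x where x: "x \<in> K \<times> sphere 0 1" "\<And>y. y \<in> K \<times> sphere 0 1 \<Longrightarrow> ?f x \<le> ?f y"
    by blast
  have ip: "is_inner_product (local_metric A g c p)" if "p \<in> K" for p
    using local_metric_inner_product[OF c] K(2) that by blast
  have x': "fst x \<in> K" "snd x \<noteq> 0" using x(1) by auto
  show ?thesis
  proof
    show "?f x > 0" using ip[OF x'(1)] x'(2) by (simp add: is_inner_product_def)
    fix p d assume p: "p \<in> K"
    have bil: "bilinear (local_metric A g c p)" using ip[OF p] by (simp add: is_inner_product_def)
    show "local_metric A g c p d d \<ge> ?f x * (norm d)\<^sup>2"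
    proof (cases "d = 0")
      case True
      then show ?thesis by (simp add: bilinear_lzero[OF bil])
    next
      case False
      have "?f x \<le> local_metric A g c p (d /\<^sub>R norm d) (d /\<^sub>R norm d)"
        using x(2)[of "(p, d /\<^sub>R norm d)"] p False by simp
      also have "\<dots> = local_metric A g c p d d / (norm d)\<^sup>2"
        by (simp add: bilinear_lmul[OF bil] bilinear_rmul[OF bil] power2_eq_square field_simps)
      finally show ?thesis using False by (simp add: field_simps)
    qed
  qed
qed (use that[of 1] in auto)

text \<open>In coordinates the expression is polynomial in the components of the vectors, with
  coefficients smooth in the base point.\<close>

lemma comparable_dmetric:
  assumes c: "c \<in> A" and K: "compact K" "convex K" "K \<subseteq> snd c ` fst c"
    and ab: "\<And>t. t \<in> T \<Longrightarrow> a t \<in> K" "\<And>t. t \<in> T \<Longrightarrow> b t \<in> K"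
    and e: "\<And>t. t \<in> T \<Longrightarrow> norm (a t - b t) \<le> e t"
    and h: "\<And>i. i \<in> Basis \<Longrightarrow> comparable T e (\<lambda>t. h t \<bullet> i) (\<lambda>t. h' t \<bullet> i)"
    and u: "\<And>i. i \<in> Basis \<Longrightarrow> comparable T e (\<lambda>t. u t \<bullet> i) (\<lambda>t. u' t \<bullet> i)"
    and v: "\<And>i. i \<in> Basis \<Longrightarrow> comparable T e (\<lambda>t. v t \<bullet> i) (\<lambda>t. v' t \<bullet> i)"
  shows "comparable T e (\<lambda>t. dmetric c (a t) (h t) (u t) (v t)) (\<lambda>t. dmetric c (b t) (h' t) (u' t) (v' t))"
proof -
  have e0: "\<And>t. t \<in> T \<Longrightarrow> e t \<ge> 0" using e norm_ge_zero order_trans by blast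
  have D: "comparable T e (\<lambda>t. dmetric c (a t) k i j) (\<lambda>t. dmetric c (b t) k i j)" for k i j
    by (rule comparable_smooth[where f = "\<lambda>p. dmetric c p k i j", OF _ K ab e])
       (use smooth_on_derivative[OF local_metric_smooth[OF c]] in \<open>auto simp: dmetric_def\<close>)
  have "comparable T e
    (\<lambda>t. \<Sum>i\<in>Basis. \<Sum>j\<in>Basis. \<Sum>k\<in>Basis. (u t \<bullet> i) * (v t \<bullet> j) * (h t \<bullet> k) * dmetric c (a t) k i j)
    (\<lambda>t. \<Sum>i\<in>Basis. \<Sum>j\<in>Basis. \<Sum>k\<in>Basis. (u' t \<bullet> i) * (v' t \<bullet> j) * (h' t \<bullet> k) * dmetric c (b t) k i j)"
    by (intro comparable_sum comparable_mult D h u v e0)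
  then show ?thesis
    by (rule comparable_cong; intro dmetric_expand[OF c]; use ab K(3) in blast)
qed

lemma comparable_local_metric:
  assumes c: "c \<in> A" and K: "compact K" "convex K" "K \<subseteq> snd c ` fst c"
    and ab: "\<And>t. t \<in> T \<Longrightarrow> a t \<in> K" "\<And>t. t \<in> T \<Longrightarrow> b t \<in> K"
    and e: "\<And>t. t \<in> T \<Longrightarrow> norm (a t - b t) \<le> e t"
    and u: "\<And>i. i \<in> Basis \<Longrightarrow> comparable T e (\<lambda>t. u t \<bullet> i) (\<lambda>t. u' t \<bullet> i)"
    and v: "\<And>i. i \<in> Basis \<Longrightarrow> comparable T e (\<lambda>t. v t \<bullet> i) (\<lambda>t. v' t \<bullet> i)"
  shows "comparable T e (\<lambda>t. local_metric A g c (a t) (u t) (v t)) (\<lambda>t. local_metric A g c (b t) (u' t) (v' t))"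
proof -
  have e0: "\<And>t. t \<in> T \<Longrightarrow> e t \<ge> 0" using e norm_ge_zero order_trans by blast
  have G: "comparable T e (\<lambda>t. local_metric A g c (a t) i j) (\<lambda>t. local_metric A g c (b t) i j)" for i j
    by (rule comparable_smooth[where f = "\<lambda>p. local_metric A g c p i j", OF local_metric_smooth[OF c] K ab e])
  have "comparable T e
    (\<lambda>t. \<Sum>i\<in>Basis. \<Sum>j\<in>Basis. (u t \<bullet> i) * (v t \<bullet> j) * local_metric A g c (a t) i j)
    (\<lambda>t. \<Sum>i\<in>Basis. \<Sum>j\<in>Basis. (u' t \<bullet> i) * (v' t \<bullet> j) * local_metric A g c (b t) i j)"
    by (intro comparable_sum comparable_mult G u v e0)
  then show ?thesis
    by (rule comparable_cong; intro local_metric_expand[OF c]; use ab K(3) in blast)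
qed

text \<open>Presents the geodesic equation as a second-order differential equation for the
  coordinate curve \<open>D 0\<close>.\<close>

lemma geodesic_in_chart:
  assumes \<gamma>: "geodesic A g \<gamma>" and c: "c \<in> A"
  obtains D :: "nat \<Rightarrow> real \<Rightarrow> 'e" where
    "\<And>t k. t \<in> {0..1} \<Longrightarrow> \<gamma> t \<in> fst c \<Longrightarrow> (D k has_vector_derivative D (Suc k) t) (at t within {0..1})"
    "\<And>t. t \<in> {0..1} \<Longrightarrow> \<gamma> t \<in> fst c \<Longrightarrow> D 0 t = snd c (\<gamma> t)"
    "\<And>t. t \<in> {0..1} \<Longrightarrow> \<gamma> t \<in> fst c \<Longrightarrow> D 1 t = cvel c \<gamma> t"
    "\<And>t. t \<in> {0..1} \<Longrightarrow> \<gamma> t \<in> fst c \<Longrightarrow> D 2 t = - christoffel A g c (snd c (\<gamma> t)) (D 1 t) (D 1 t)"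
proof -
  have smooth: "smooth_curve_on A {0..1} \<gamma>" and cont: "continuous_on {0..1} \<gamma>"
    using \<gamma> by (auto simp: geodesic_def smooth_curve_on_def)
  obtain D where D: "\<forall>t\<in>{t\<in>{0..1}. \<gamma> t \<in> fst c}. D 0 t = snd c (\<gamma> t) \<and>
        (\<forall>k::nat. (D k has_vector_derivative D (Suc k) t) (at t within {t\<in>{0..1}. \<gamma> t \<in> fst c}))"
    using smooth c unfolding smooth_curve_on_def by blast
  note der = chart_derivatives[OF c cont D]
  show ?thesis
  proof
    fix t :: real assume t: "t \<in> {0..1}" "\<gamma> t \<in> fst c"
    show "(D k has_vector_derivative D (Suc k) t) (at t within {0..1})" for k using der(1)[OF t] .
    show "D 0 t = snd c (\<gamma> t)" using D t by blast
    show "D 1 t = cvel c \<gamma> t" using der(3)[OF t] by simp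
    have "covariant_acceleration A g c \<gamma> t = 0" using \<gamma> c t by (auto simp: geodesic_def)
    then show "D 2 t = - christoffel A g c (snd c (\<gamma> t)) (D 1 t) (D 1 t)"
      using der(5)[OF t] by (simp add: eq_neg_iff_add_eq_0)
  qed
qed

lemma continuous_nbhd:
  assumes "continuous_on {0..1} \<gamma>" "open U" "s \<in> {0..1}" "\<gamma> s \<in> U"
  obtains \<delta> :: real where "\<delta> > 0" "\<And>t. t \<in> {0..1} \<Longrightarrow> \<bar>t - s\<bar> < \<delta> \<Longrightarrow> \<gamma> t \<in> U"
proof -
  obtain S where S: "open S" "S \<inter> {0..1} = \<gamma> -` U \<inter> {0..1}"
    using assms(1,2) unfolding continuous_on_open_invariant by blast
  then have "s \<in> S" using assms(3,4) by blast
  then obtain \<delta> where "\<delta> > 0" "ball s \<delta> \<subseteq> S" using S(1) openE by blast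
  moreover have "\<gamma> t \<in> U" if "t \<in> {0..1}" "t \<in> S" for t using S(2) that by blast
  ultimately show ?thesis by (intro that[of \<delta>]) (auto simp: dist_real_def abs_minus_commute subset_eq)
qed

text \<open>For a short time both curves stay in one coordinate ball, where the metric estimates are
  uniform and their difference satisfies the hypothesis of
  \<open>second_order_unique\<close>.\<close>

lemma geodesic_local_unique:
  assumes \<gamma>: "geodesic A g \<gamma>" and \<sigma>: "geodesic A g \<sigma>" and c: "c \<in> A" and s: "0 \<le> s" "s < 1"
    and eq: "\<gamma> s = \<sigma> s" "cvel c \<gamma> s = cvel c \<sigma> s" and dom: "\<gamma> s \<in> fst c"
  obtains r where "s < r" "r \<le> 1" "\<And>t. t \<in> {s..r} \<Longrightarrow> \<gamma> t = \<sigma> t"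
proof -
  obtain Da where Da:
    "\<And>t k. t \<in> {0..1} \<Longrightarrow> \<gamma> t \<in> fst c \<Longrightarrow> (Da k has_vector_derivative Da (Suc k) t) (at t within {0..1})"
    "\<And>t. t \<in> {0..1} \<Longrightarrow> \<gamma> t \<in> fst c \<Longrightarrow> Da 0 t = snd c (\<gamma> t)"
    "\<And>t. t \<in> {0..1} \<Longrightarrow> \<gamma> t \<in> fst c \<Longrightarrow> Da 1 t = cvel c \<gamma> t"
    "\<And>t. t \<in> {0..1} \<Longrightarrow> \<gamma> t \<in> fst c \<Longrightarrow> Da 2 t = - christoffel A g c (snd c (\<gamma> t)) (Da 1 t) (Da 1 t)"
    using geodesic_in_chart[OF \<gamma> c] by blast
  obtain Db where Db:
    "\<And>t k. t \<in> {0..1} \<Longrightarrow> \<sigma> t \<in> fst c \<Longrightarrow> (Db k has_vector_derivative Db (Suc k) t) (at t within {0..1})"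
    "\<And>t. t \<in> {0..1} \<Longrightarrow> \<sigma> t \<in> fst c \<Longrightarrow> Db 0 t = snd c (\<sigma> t)"
    "\<And>t. t \<in> {0..1} \<Longrightarrow> \<sigma> t \<in> fst c \<Longrightarrow> Db 1 t = cvel c \<sigma> t"
    "\<And>t. t \<in> {0..1} \<Longrightarrow> \<sigma> t \<in> fst c \<Longrightarrow> Db 2 t = - christoffel A g c (snd c (\<sigma> t)) (Db 1 t) (Db 1 t)"
    using geodesic_in_chart[OF \<sigma> c] by blast
  have cont: "continuous_on {0..1} \<gamma>" "continuous_on {0..1} \<sigma>"
    using \<gamma> \<sigma> by (auto simp: geodesic_def smooth_curve_on_def)
  have s01: "s \<in> {0..1}" using s by auto
  obtain \<rho> where \<rho>: "\<rho> > 0" "cball (snd c (\<gamma> s)) \<rho> \<subseteq> snd c ` fst c"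
    using open_contains_cball[of "snd c ` fst c"] open_chart(2)[OF c] dom by blast
  \<comment> \<open>A closed ball is compact and convex, as the Lipschitz and coercivity bounds
    require.\<close>
  define K where "K = cball (snd c (\<gamma> s)) \<rho>"
  have K: "compact K" "convex K" "K \<subseteq> snd c ` fst c" using \<rho>(2) by (auto simp: K_def)
  define U where "U = snd c -` ball (snd c (\<gamma> s)) \<rho> \<inter> fst c"
  have "open U"
    using continuous_on_open_vimage[OF open_chart(1)[OF c]] continuous_chart(1)[OF c]
    unfolding U_def by blast
  have U: "x \<in> fst c" "snd c x \<in> K" if "x \<in> U" for x
    using that by (auto simp: U_def K_def)
  have "\<gamma> s \<in> U" using dom \<rho>(1) by (simp add: U_def)
  obtain \<delta>1 where \<delta>1: "\<delta>1 > 0" "\<And>t. t \<in> {0..1} \<Longrightarrow> \<bar>t - s\<bar> < \<delta>1 \<Longrightarrow> \<gamma> t \<in> U"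
    using continuous_nbhd[OF cont(1) \<open>open U\<close> s01 \<open>\<gamma> s \<in> U\<close>] by blast
  obtain \<delta>2 where \<delta>2: "\<delta>2 > 0" "\<And>t. t \<in> {0..1} \<Longrightarrow> \<bar>t - s\<bar> < \<delta>2 \<Longrightarrow> \<sigma> t \<in> U"
    using continuous_nbhd[OF cont(2) \<open>open U\<close> s01] \<open>\<gamma> s \<in> U\<close> eq(1) by metis
  \<comment> \<open>Halving keeps the closed interval \<open>{s..r}\<close> strictly inside both
    neighbourhoods.\<close>
  define r where "r = min 1 (s + min \<delta>1 \<delta>2 / 2)"
  have r: "s < r" "r \<le> 1" using s \<delta>1(1) \<delta>2(1) by (auto simp: r_def)
  have T: "t \<in> {0..1}" "\<gamma> t \<in> U" "\<sigma> t \<in> U" if "t \<in> {s..r}" for t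
  proof -
    show "t \<in> {0..1}" using that s r by auto
    have "\<bar>t - s\<bar> < \<delta>1" "\<bar>t - s\<bar> < \<delta>2" using that \<delta>1(1) \<delta>2(1) by (auto simp: r_def min_def split: if_splits)
    then show "\<gamma> t \<in> U" "\<sigma> t \<in> U" using \<delta>1(2) \<delta>2(2) \<open>t \<in> {0..1}\<close> by auto
  qed
  have dDa: "(Da k has_vector_derivative Da (Suc k) t) (at t within {s..r})" if "t \<in> {s..r}" for t k
    by (rule has_vector_derivative_within_subset[OF Da(1)[OF T(1)[OF that] U(1)[OF T(2)[OF that]]]]) (use T(1) in blast)
  have dDb: "(Db k has_vector_derivative Db (Suc k) t) (at t within {s..r})" if "t \<in> {s..r}" for t k
    by (rule has_vector_derivative_within_subset[OF Db(1)[OF T(1)[OF that] U(1)[OF T(3)[OF that]]]]) (use T(1) in blast)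
  have "continuous_on {s..r} (Da k)" for k
    by (rule continuous_on_vector_derivative) (rule dDa)
  moreover have "continuous_on {s..r} (Db k)" for k
    by (rule continuous_on_vector_derivative) (rule dDb)
  ultimately have "\<exists>B. \<forall>t\<in>{s..r}. norm (Da k t) \<le> B" "\<exists>B. \<forall>t\<in>{s..r}. norm (Db k t) \<le> B" for k
    using bounded_on_interval by blast+
  then obtain Ba Bb where B: "\<And>k t. t \<in> {s..r} \<Longrightarrow> norm (Da k t) \<le> Ba k"
    "\<And>k t. t \<in> {s..r} \<Longrightarrow> norm (Db k t) \<le> Bb k" by metis
  define e where "e t = norm (Da 0 t - Db 0 t) + norm (Da 1 t - Db 1 t)" for t
  have e0: "e t \<ge> 0" for t by (simp add: e_def)
  have ab: "Da 0 t \<in> K" "Db 0 t \<in> K" if "t \<in> {s..r}" for t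
    using Da(2)[OF T(1)[OF that] U(1)[OF T(2)[OF that]]] Db(2)[OF T(1)[OF that] U(1)[OF T(3)[OF that]]]
      U(2)[OF T(2)[OF that]] U(2)[OF T(3)[OF that]] by simp_all
  have abe: "norm (Da 0 t - Db 0 t) \<le> e t" for t by (simp add: e_def)
  have vel: "comparable {s..r} e (\<lambda>t. Da 1 t \<bullet> i) (\<lambda>t. Db 1 t \<bullet> i)" if i: "i \<in> Basis" for i
  proof (rule comparableI[of _ _ "Ba 1" _ "Bb 1" 1])
    fix t assume t: "t \<in> {s..r}"
    show "\<bar>Da 1 t \<bullet> i\<bar> \<le> Ba 1" "\<bar>Db 1 t \<bullet> i\<bar> \<le> Bb 1"
      using Basis_le_norm[OF i] B(1)[OF t, of 1] B(2)[OF t, of 1] order_trans by blast+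
    show "\<bar>Da 1 t \<bullet> i - Db 1 t \<bullet> i\<bar> \<le> 1 * e t"
      using Basis_le_norm[OF i, of "Da 1 t - Db 1 t"] norm_ge_zero[of "Da 0 t - Db 0 t"]
      unfolding e_def inner_diff_left mult_1 by linarith
  qed (rule e0)
  \<comment> \<open>The acceleration \<open>Db 2\<close> is compared with itself, which takes only
    boundedness: it is kept fixed while the base point of the metric moves.\<close>
  have acc: "comparable {s..r} e (\<lambda>t. Db 2 t \<bullet> i) (\<lambda>t. Db 2 t \<bullet> i)" if i: "i \<in> Basis" for i
  proof (rule comparableI[of _ _ "Bb 2" _ "Bb 2" 0])
    fix t assume t: "t \<in> {s..r}"
    show "\<bar>Db 2 t \<bullet> i\<bar> \<le> Bb 2" "\<bar>Db 2 t \<bullet> i\<bar> \<le> Bb 2"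
      using Basis_le_norm[OF i] B(2)[OF t, of 2] order_trans by blast+
  qed (use e0 in auto)
  have const: "comparable {s..r} e (\<lambda>t. k) (\<lambda>t. k)" for k
    by (rule comparable_const) (rule e0)
  (* Pairing the accelerations with a fixed vector j avoids inverting the metric: the geodesic
     equation says G (a'', j) = - koszul (a', a', j). *)
  have "\<exists>M\<ge>0. \<forall>t\<in>{s..r}. \<bar>local_metric A g c (Da 0 t) (Da 2 t - Db 2 t) j\<bar> \<le> M * e t" for j
  proof -
    \<comment> \<open>By the geodesic equation the second function vanishes and the first is
      \<open>local_metric\<close> at \<open>Da 0 t\<close> of \<open>Db 2 t - Da 2 t\<close> and
      \<open>j\<close>. Halving and subtraction are written as products to fit the rules for
      \<open>comparable\<close>.\<close>
    have "comparable {s..r} e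
      (\<lambda>t. 1/2 * (dmetric c (Da 0 t) (Da 1 t) (Da 1 t) j + dmetric c (Da 0 t) (Da 1 t) (Da 1 t) j
        + - 1 * dmetric c (Da 0 t) j (Da 1 t) (Da 1 t)) + local_metric A g c (Da 0 t) (Db 2 t) j)
      (\<lambda>t. 1/2 * (dmetric c (Db 0 t) (Db 1 t) (Db 1 t) j + dmetric c (Db 0 t) (Db 1 t) (Db 1 t) j
        + - 1 * dmetric c (Db 0 t) j (Db 1 t) (Db 1 t)) + local_metric A g c (Db 0 t) (Db 2 t) j)"
      by (intro comparable_add comparable_mult const e0
          comparable_dmetric[OF c K ab abe] comparable_local_metric[OF c K ab abe] vel acc)
    then obtain M where M: "M \<ge> 0" "\<And>t. t \<in> {s..r} \<Longrightarrow>
      \<bar>koszul c (Da 0 t) (Da 1 t) j + local_metric A g c (Da 0 t) (Db 2 t) j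
       - (koszul c (Db 0 t) (Db 1 t) j + local_metric A g c (Db 0 t) (Db 2 t) j)\<bar> \<le> M * e t"
      unfolding comparable_def koszul_def by force
    have "\<bar>local_metric A g c (Da 0 t) (Da 2 t - Db 2 t) j\<bar> \<le> M * e t" if t: "t \<in> {s..r}" for t
    proof -
      have p: "Da 0 t \<in> snd c ` fst c" and q: "Db 0 t \<in> snd c ` fst c" using ab[OF t] K(3) by auto
      have bila: "bilinear (local_metric A g c (Da 0 t))" and bilb: "bilinear (local_metric A g c (Db 0 t))"
        using local_metric_inner_product[OF c p] local_metric_inner_product[OF c q]
        by (auto simp: is_inner_product_def)
      have a2: "Da 2 t = - christoffel A g c (Da 0 t) (Da 1 t) (Da 1 t)"
        using Da(2,4)[OF T(1)[OF t] U(1)[OF T(2)[OF t]]] by simp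
      have b2: "Db 2 t = - christoffel A g c (Db 0 t) (Db 1 t) (Db 1 t)"
        using Db(2,4)[OF T(1)[OF t] U(1)[OF T(3)[OF t]]] by simp
      have "local_metric A g c (Da 0 t) (Da 2 t) j = - koszul c (Da 0 t) (Da 1 t) j"
        unfolding a2 by (simp add: bilinear_lneg[OF bila] christoffel_koszul[OF c p])
      moreover have "local_metric A g c (Db 0 t) (Db 2 t) j = - koszul c (Db 0 t) (Db 1 t) j"
        unfolding b2 by (simp add: bilinear_lneg[OF bilb] christoffel_koszul[OF c q])
      ultimately show ?thesis using M(2)[OF t] unfolding bilinear_lsub[OF bila] by linarith
    qed
    with M(1) show ?thesis by blast
  qed
  then obtain M where M: "\<And>j. M j \<ge> 0"
    "\<And>j t. t \<in> {s..r} \<Longrightarrow> \<bar>local_metric A g c (Da 0 t) (Da 2 t - Db 2 t) j\<bar> \<le> M j * e t" by metis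
  obtain l where l: "l > 0" "\<And>p d. p \<in> K \<Longrightarrow> local_metric A g c p d d \<ge> l * (norm d)\<^sup>2"
    using local_metric_coercive[OF c K(1,3)] by blast
  define N where "N = (\<Sum>j\<in>Basis. M j)"
  have N: "N \<ge> 0" using M(1) by (simp add: N_def sum_nonneg)
  have bound: "norm (Da 2 t - Db 2 t) \<le> N / l * (norm (Da 0 t - Db 0 t) + norm (Da 1 t - Db 1 t))"
    if t: "t \<in> {s..r}" for t
  proof -
    define d where "d = Da 2 t - Db 2 t"
    have p: "Da 0 t \<in> snd c ` fst c" using ab[OF t] K(3) by auto
    have bil: "bilinear (local_metric A g c (Da 0 t))"
      using local_metric_inner_product[OF c p] by (auto simp: is_inner_product_def)
    then have lin: "linear (local_metric A g c (Da 0 t) d)" by (simp add: bilinear_def)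
    \<comment> \<open>Coercivity, followed by expansion of the second argument only: the bounds
      \<open>M j\<close> are available for each basis vector \<open>j\<close>. One factor
      \<open>norm d\<close> then cancels.\<close>
    have "l * (norm d)\<^sup>2 \<le> local_metric A g c (Da 0 t) d d" using l(2) ab[OF t] by blast
    also have "\<dots> = local_metric A g c (Da 0 t) d (\<Sum>j\<in>Basis. (d \<bullet> j) *\<^sub>R j)"
      by (simp add: euclidean_representation)
    also have "\<dots> = (\<Sum>j\<in>Basis. (d \<bullet> j) * local_metric A g c (Da 0 t) d j)"
      by (simp add: linear_sum[OF lin] linear_cmul[OF lin])
    also have "\<dots> \<le> (\<Sum>j\<in>Basis. norm d * (M j * e t))"
    proof (rule sum_mono)
      fix j :: 'e assume j: "j \<in> Basis"
      have "(d \<bullet> j) * local_metric A g c (Da 0 t) d j \<le> \<bar>d \<bullet> j\<bar> * \<bar>local_metric A g c (Da 0 t) d j\<bar>"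
        by (metis abs_ge_self abs_mult)
      also have "\<dots> \<le> norm d * (M j * e t)"
        using Basis_le_norm[OF j] M(2)[OF t] by (intro mult_mono) (auto simp: d_def)
      finally show "(d \<bullet> j) * local_metric A g c (Da 0 t) d j \<le> norm d * (M j * e t)" .
    qed
    also have "\<dots> = norm d * (N * e t)" by (simp add: N_def sum_distrib_left sum_distrib_right)
    finally have "norm d * (l * norm d) \<le> norm d * (N * e t)" by (simp add: power2_eq_square algebra_simps)
    then have "l * norm d \<le> N * e t"
      using N e0[of t] by (cases "d = 0") simp_all
    then show ?thesis using l(1) by (simp add: d_def e_def field_simps)
  qed
  have sr: "s \<in> {s..r}" using r by simp
  have "Da 0 t = Db 0 t" if t: "t \<in> {s..r}" for t
  proof (rule second_order_unique[where a' = "Da 1" and b' = "Db 1" and M = "N / l" and a'' = "Da 2" and b'' = "Db 2"])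
    show "Da 0 s = Db 0 s"
      using Da(2)[OF T(1)[OF sr] U(1)[OF T(2)[OF sr]]] Db(2)[OF T(1)[OF sr] U(1)[OF T(3)[OF sr]]] eq(1) by simp
    show "Da 1 s = Db 1 s"
      using Da(3)[OF T(1)[OF sr] U(1)[OF T(2)[OF sr]]] Db(3)[OF T(1)[OF sr] U(1)[OF T(3)[OF sr]]] eq(2) by simp
    show "N / l \<ge> 0" using N l(1) by simp
    show "t \<in> {s..r}" by (rule t)
  qed (use dDa[of _ 0] dDa[of _ 1] dDb[of _ 0] dDb[of _ 1] bound in \<open>simp_all add: numeral_2_eq_2\<close>)
  then have "\<gamma> t = \<sigma> t" if t: "t \<in> {s..r}" for t
    using Da(2)[OF T(1)[OF t] U(1)[OF T(2)[OF t]]] Db(2)[OF T(1)[OF t] U(1)[OF T(3)[OF t]]]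
      chart_inv_chart[OF c U(1)[OF T(2)[OF t]]] chart_inv_chart[OF c U(1)[OF T(3)[OF t]]] t by metis
  with r show ?thesis by (rule that)
qed

text \<open>Let \<open>s\<close> be the infimum of the times of disagreement. Positions and
  velocities still agree at \<open>s\<close>, so local uniqueness extends the agreement beyond
  \<open>s\<close>, a contradiction.\<close>

lemma geodesic_unique:
  assumes \<gamma>: "geodesic A g \<gamma>" and \<sigma>: "geodesic A g \<sigma>"
    and init: "\<gamma> 0 = \<sigma> 0" "velocity A \<gamma> 0 = velocity A \<sigma> 0" and t: "t \<in> {0..1}"
  shows "\<gamma> t = \<sigma> t"
proof (rule ccontr)
  assume neq: "\<gamma> t \<noteq> \<sigma> t"
  define N where "N = {t\<in>{0..1}. \<gamma> t \<noteq> \<sigma> t}"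
  define s where "s = Inf N"
  have N: "N \<noteq> {}" "bdd_below N" using t neq by (auto simp: N_def intro!: bdd_belowI[of _ 0])
  have s0: "0 \<le> s" unfolding s_def by (rule cInf_greatest) (use N in \<open>auto simp: N_def\<close>)
  have s_le: "s \<le> n" if "n \<in> N" for n unfolding s_def by (rule cInf_lower) (use N that in auto)
  have before: "\<gamma> u = \<sigma> u" if "0 \<le> u" "u < s" for u
    using that s_le[of u] s_le[of t] t neq by (auto simp: N_def)
  have s1: "s \<le> 1" using s_le[of t] t neq by (auto simp: N_def)
  have smooth: "smooth_curve_on A {0..1} \<gamma>" "smooth_curve_on A {0..1} \<sigma>"
    and cont: "continuous_on {0..1} \<gamma>" "continuous_on {0..1} \<sigma>"
    using \<gamma> \<sigma> by (auto simp: geodesic_def smooth_curve_on_def)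
  \<comment> \<open>For positive \<open>s\<close> the curves have the same left limit at
    \<open>s\<close>, and limits are unique in a Hausdorff space.\<close>
  have at_s: "\<gamma> s = \<sigma> s"
  proof (cases "s = 0")
    case False
    then have s: "0 < s" using s0 by simp
    have "(\<gamma> \<longlongrightarrow> \<gamma> s) (at s within {0..s})" "(\<sigma> \<longlongrightarrow> \<sigma> s) (at s within {0..s})"
      using continuous_on_subset[OF cont(1), of "{0..s}"] continuous_on_subset[OF cont(2), of "{0..s}"] s s1
      by (auto simp: continuous_on_def)
    then have lim: "(\<gamma> \<longlongrightarrow> \<gamma> s) (at_left s)" "(\<sigma> \<longlongrightarrow> \<sigma> s) (at_left s)"
      by (simp_all add: at_within_Icc_at_left[OF s])
    have "eventually (\<lambda>u. \<sigma> u = \<gamma> u) (at_left s)"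
      using eventually_at_left_real[OF s] by eventually_elim (use before in auto)
    then have "(\<gamma> \<longlongrightarrow> \<sigma> s) (at_left s)" using lim(2) tendsto_cong by fastforce
    then show ?thesis using tendsto_unique[OF _ lim(1)] by simp
  qed (use init in simp)
  then have "s \<noteq> n" if "n \<in> N" for n using that by (auto simp: N_def)
  then have s_less: "s < n" if "n \<in> N" for n using s_le that by (metis order_le_less)
  have "s < t" using s_less t neq by (simp add: N_def)
  then have s: "0 \<le> s" "s < 1" "s \<in> {0..1}" using s0 t by auto
  let ?c = "chart_at A (\<gamma> s)"
  have c: "?c \<in> A" "\<gamma> s \<in> fst ?c" "\<sigma> s \<in> fst ?c" using chart_at_mem[of "\<gamma> s"] at_s by auto
  \<comment> \<open>At 0 this is the hypothesis on \<open>velocity\<close>, since both curves use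
    the preferred chart of their common starting point. At positive \<open>s\<close> the derivative
    is determined from the left, where the curves coincide.\<close>
  have "cvel ?c \<gamma> s = cvel ?c \<sigma> s"
  proof (cases "s = 0")
    case True
    then show ?thesis using init by (simp add: velocity_def cvel_def)
  next
    case False
    have "((snd ?c \<circ> \<gamma>) has_vector_derivative cvel ?c \<gamma> s) (at s within {0..1})"
      "((snd ?c \<circ> \<sigma>) has_vector_derivative cvel ?c \<sigma> s) (at s within {0..1})"
      using has_vector_derivative_cvel[OF smooth(1) c(1) s(3) c(2)]
        has_vector_derivative_cvel[OF smooth(2) c(1) s(3) c(3)] by auto
    then have d: "((snd ?c \<circ> \<gamma>) has_vector_derivative cvel ?c \<gamma> s) (at s within {0..s})"
      "((snd ?c \<circ> \<sigma>) has_vector_derivative cvel ?c \<sigma> s) (at s within {0..s})"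
      using s by (auto elim!: has_vector_derivative_within_subset)
    have "((snd ?c \<circ> \<gamma>) has_vector_derivative cvel ?c \<sigma> s) (at s within {0..s})"
      by (rule has_vector_derivative_transform[OF _ _ d(2)])
         (use before at_s s in \<open>auto simp: order_le_less\<close>)
    then have "vector_derivative (snd ?c \<circ> \<gamma>) (at s within {0..s}) = cvel ?c \<sigma> s"
      by (intro vector_derivative_within_closed_interval) (use s False in auto)
    moreover have "vector_derivative (snd ?c \<circ> \<gamma>) (at s within {0..s}) = cvel ?c \<gamma> s"
      by (rule vector_derivative_within_closed_interval) (use d(1) s False in auto)
    ultimately show ?thesis by simp
  qed
  then obtain r where r: "s < r" "\<And>u. u \<in> {s..r} \<Longrightarrow> \<gamma> u = \<sigma> u"
    using geodesic_local_unique[OF \<gamma> \<sigma> c(1) s(1,2) at_s _ c(2)] by metis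
  have "r \<le> n" if "n \<in> N" for n
    using r(2)[of n] s_less[OF that] that by (force simp: N_def)
  then have "r \<le> s" unfolding s_def using N(1) by (intro cInf_greatest)
  then show False using r(1) by simp
qed

section \<open>The exponential map and its inverse\<close>

text \<open>Uniqueness of geodesics makes the definite description in \<open>riem_exp\<close>
  proper.\<close>

lemma riem_exp_velocity:
  assumes \<gamma>: "geodesic A g \<gamma>"
  shows "riem_exp A g (\<gamma> 0) (velocity A \<gamma> 0) = \<gamma> 1"
  unfolding riem_exp_def
proof (rule the_equality)
  show "\<exists>\<sigma>. geodesic A g \<sigma> \<and> \<sigma> 0 = \<gamma> 0 \<and> velocity A \<sigma> 0 = velocity A \<gamma> 0 \<and> \<sigma> 1 = \<gamma> 1"
    using \<gamma> by blast
  fix y assume "\<exists>\<sigma>. geodesic A g \<sigma> \<and> \<sigma> 0 = \<gamma> 0 \<and> velocity A \<sigma> 0 = velocity A \<gamma> 0 \<and> \<sigma> 1 = y"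
  then show "y = \<gamma> 1" using geodesic_unique[OF _ \<gamma>, of _ 1] by auto
qed

text \<open>Identifies the ray used in \<open>log_range\<close> with the geodesic itself, by
  rescaling time.\<close>

lemma riem_exp_scaled_velocity:
  assumes "geodesic A g \<gamma>" "s \<in> {0..1}"
  shows "riem_exp A g (\<gamma> 0) (s *\<^sub>R velocity A \<gamma> 0) = \<gamma> s"
  using riem_exp_velocity[OF geodesic_scale(1)[OF assms]] geodesic_scale(2)[OF assms] by simp

section \<open>Constant curves and the logarithm of the base point\<close>

lemma smooth_curve_const: "smooth_curve_on A {0..1} (\<lambda>t. x)"
  unfolding smooth_curve_on_def
proof (intro conjI ballI)
  fix c assume "c \<in> A"
  show "\<exists>D. \<forall>t\<in>{t \<in> {0..1}. x \<in> fst c}. D 0 t = snd c x \<and>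
    (\<forall>k::nat. (D k has_vector_derivative D (Suc k) t) (at t within {t \<in> {0..1}. x \<in> fst c}))"
    by (rule exI[of _ "\<lambda>k t. if k = 0 then snd c x else 0"]) simp
qed simp

lemma geodesic_const: "geodesic A g (\<lambda>t. x)"
  unfolding geodesic_def
proof (intro conjI ballI impI)
  fix c t assume c: "c \<in> A" and t: "t \<in> {0..1::real}" "x \<in> fst c"
  define D :: "nat \<Rightarrow> real \<Rightarrow> 'e" where "D k t = (if k = 0 then snd c x else 0)" for k t
  have D: "\<forall>t\<in>{t \<in> {0..1}. x \<in> fst c}. D 0 t = snd c x \<and>
    (\<forall>k::nat. (D k has_vector_derivative D (Suc k) t) (at t within {t \<in> {0..1}. x \<in> fst c}))"
    by (simp add: D_def[abs_def])
  \<comment> \<open>Homogeneity of degree two, with factor 0.\<close>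
  have "christoffel A g c (snd c x) 0 0 = 0"
    using christoffel_scale[OF c, of "snd c x" 0 0] t by simp
  then show "covariant_acceleration A g c (\<lambda>t. x) t = 0"
    using chart_derivatives(5)[OF c continuous_on_const D t] by (simp add: D_def)
qed (rule smooth_curve_const)

lemma curve_length_const: "curve_length A g (\<lambda>t. x) = 0"
proof -
  have "curve_length A g (\<lambda>t. x) = integral {0..1::real} (\<lambda>t. 0)"
    unfolding curve_length_def
    by (rule integral_cong) (simp add: velocity_const ip_norm_eq_0)
  then show ?thesis by simp
qed

text \<open>The constant curve attains the infimum, all lengths being nonnegative.\<close>

lemma riem_dist_self: "riem_dist A g x x = 0"
  unfolding riem_dist_def
proof (rule cInf_eq_minimum)
  have "piecewise_smooth_curve A (\<lambda>t. x)"
    unfolding piecewise_smooth_curve_def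
    by (intro conjI exI[of _ "{0, 1}"]) (auto simp: smooth_curve_const)
  then show "0 \<in> {curve_length A g \<gamma> |\<gamma>. piecewise_smooth_curve A \<gamma> \<and> \<gamma> 0 = x \<and> \<gamma> 1 = x}"
    using curve_length_const[of x] by (intro CollectI exI[of _ "\<lambda>t. x"]) simp
qed (auto simp: curve_length_nonneg)

text \<open>Derivatives are taken within \<open>{0..1}\<close>, so values elsewhere do not matter; a
  geodesic and its exponential ray are only known to agree there.\<close>

lemma curve_length_cong:
  assumes "\<And>t. t \<in> {0..1} \<Longrightarrow> \<gamma> t = \<sigma> t"
  shows "curve_length A g \<gamma> = curve_length A g \<sigma>"
  unfolding curve_length_def
proof (rule integral_cong)
  fix t :: real assume t: "t \<in> {0..1}"
  have "velocity A \<gamma> t = velocity A \<sigma> t"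
    unfolding velocity_def assms[OF t]
    by (rule vector_derivative_cong_eq) (use assms t in auto)
  then show "ip_norm (g (\<gamma> t)) (velocity A \<gamma> t) = ip_norm (g (\<sigma> t)) (velocity A \<sigma> t)"
    by (simp add: assms[OF t])
qed

text \<open>\<open>inv_into\<close> returns some vector of \<open>log_range\<close> with image
  \<open>x\<close> once one exists. Zero is such a witness, and any such vector is the initial
  velocity of a geodesic of length 0, hence 0.\<close>

lemma riem_log_self:
  assumes x: "x \<in> C"
  shows "riem_log A g C x x = 0"
proof -
  have exp0: "riem_exp A g x 0 = x"
    using riem_exp_velocity[OF geodesic_const, of x] velocity_const[of 0 x] by simp
  have "0 \<in> exp_dom A g x"
    unfolding exp_dom_def using geodesic_const[of x] velocity_const[of 0 x] by force
  then have "0 \<in> log_range A g C x"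
    using x by (simp add: log_range_def exp0 minimizing_def curve_length_const riem_dist_self)
  then have im: "x \<in> riem_exp A g x ` log_range A g C x" using exp0 by force
  define v where "v = riem_log A g C x x"
  have v: "v \<in> log_range A g C x" "riem_exp A g x v = x"
    using inv_into_into[OF im] f_inv_into_f[OF im] by (auto simp: v_def riem_log_def)
  then obtain \<gamma> where \<gamma>: "geodesic A g \<gamma>" "\<gamma> 0 = x" "velocity A \<gamma> 0 = v"
    by (auto simp: log_range_def exp_dom_def)
  have "curve_length A g \<gamma> = curve_length A g (\<lambda>t. riem_exp A g x (t *\<^sub>R v))"
    using riem_exp_scaled_velocity[OF \<gamma>(1)] \<gamma>(2,3) by (intro curve_length_cong) simp
  also have "\<dots> = 0"
    using v by (simp add: log_range_def minimizing_def exp0 riem_dist_self)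
  finally have "velocity A \<gamma> 0 = 0"
    using \<gamma>(1) by (intro velocity_eq_0_if_length_0) (auto simp: geodesic_def)
  then show ?thesis using \<gamma>(3) by (simp add: v_def)
qed

end

section \<open>The scaling inequality\<close>

theorem proposition4p1:
  fixes A :: "('m::{t2_space, second_countable_topology}, 'e::euclidean_space) chart set"
    and g :: "'m \<Rightarrow> 'e \<Rightarrow> 'e \<Rightarrow> real"
    and C :: "'m set" and \<alpha> :: real
  assumes "riemannian_manifold A g"
    and "compact C"
    and "uniquely_geodesically_convex A g C"
    and "\<alpha> > 0"
    and "riemannian_strongly_convex A g \<alpha> C"
  shows "riemannian_scaling_inequality A g C"
  unfolding riemannian_scaling_inequality_def
\<comment> \<open>The constant comes from the Euclidean argument in each tangent space and depends
  on neither the base point nor \<open>w\<close>, so it can be fixed first.\<close>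
proof (intro exI[of _ "\<alpha> / 2"] conjI ballI allI impI)
  interpret riemannian A g by unfold_locales (rule assms(1))
  show "\<alpha> / 2 > 0" using assms(4) by simp
  fix x w v
  assume x: "x \<in> C" and "is_arg_max (\<lambda>z. g x w (riem_log A g C x z)) (\<lambda>z. z \<in> C) v"
  then have v: "v \<in> C" "\<And>z. z \<in> C \<Longrightarrow> g x w (riem_log A g C x z) \<le> g x w (riem_log A g C x v)"
    by (auto simp: is_arg_max_linorder)
  show "\<alpha> / 2 * ip_norm (g x) w * (ip_norm (g x) (riem_log A g C x v))\<^sup>2 \<le> g x w (riem_log A g C x v)"
  proof (rule strongly_convex_scaling[OF metric_inner_product])
    show "strongly_convex_set (g x) \<alpha> (riem_log A g C x ` C)"
      using assms(5) x by (simp add: riemannian_strongly_convex_def)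
    show "0 \<in> riem_log A g C x ` C" using riem_log_self[OF x] x by force
  qed (use v in auto)
qed

end
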